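(* Let $d,N\ge1$ be integers, let $\sigma>0$ and $\alpha>0$, let $V_i:\mathbb R^d\to\mathbb R$ be $\alpha$-strongly convex for each $i\in\{1,\dots,N\}$, and let $\mathcal F_0:\mathcal P_2(\mathbb R^d)\to\mathbb R$ satisfy, for some constants $\beta,B<\infty$: (A1) $\mathcal F_0((1-t)\nu_0+t\nu_1)\le (1-t)\mathcal F_0(\nu_0)+t\mathcal F_0(\nu_1)$ for all $\nu_0,\nu_1\in\mathcal P_2(\mathbb R^d)$, $t\in[0,1]$; (A2) $\|\nabla_1\nabla_2\delta^2\mathcal F_0(\nu,x,y)\|_{\mathrm{op}}\le\beta$ for all $\nu\in\mathcal P_2(\mathbb R^d)$, $x,y\in\mathbb R^d$; (A3) $\|\nabla\delta\mathcal F_0(\nu,x)\|\le B$ for all $\nu\in\mathcal P_2(\mathbb R^d)$, $x\in\mathbb R^d$. Let $\mu^{1:N}$ be the probability measure on $\mathbb R^{N\times d}$ with density $$\mu^{1:N}(x^{1:N})\propto\exp\Bigl(-\sum_{i=1}^NV_i(x^i)-\frac{2N}{\sigma^2}\,\mathcal F_0(\rho_{x^{1:N}})\Bigr),\qquad\rho_{x^{1:N}}=\frac1N\sum_{i=1}^N\delta_{x^i},$$ and let $\pi^1,\dots,\pi^N$ be probability measures on $\mathbb R^d$ with densities satisfying the coupled system $$\pi^i(x^i)\propto\exp\Bigl(-V_i(x^i)-\frac{2}{\sigma^2}\,\delta\mathcal F_0(\bar\pi,x^i)\Bigr),\quad i=1,\dots,N,\qquad\bar\pi=\frac1N\sum_{i=1}^N\pi^i,$$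 where all these measures are assumed to be well-defined. Set $\pi^{1:N}=\bigotimes_{i=1}^N\pi^i$. Assume that each $\pi^i$ satisfies a Poincaré inequality with constant $\bar C_{\mathsf{PI}}$. Then $$\mathrm{KL}(\mu^{1:N}\,\|\,\pi^{1:N})\le\frac{4\beta}{\sigma^2}\min\Bigl\{\bar C_{\mathsf{PI}}\,d,\ \frac{2d}{\alpha}+\frac{4B^2}{\alpha^2\sigma^4}\Bigr\}.$$
   Context: $\mathcal P_2(\mathbb R^d)$ is the set of probability measures on $\mathbb R^d$ with finite second moment. A point $x^{1:N}\in\mathbb R^{N\times d}$ is written $x^{1:N}=[x^1,\dots,x^N]$ with $x^i\in\mathbb R^d$. $\mathrm{KL}(\mu\|\pi)=\int\log\frac{d\mu}{d\pi}\,d\mu$. A probability measure $\nu$ satisfies a Poincaré inequality with constant $C$ if $\mathrm{Var}_\nu f\le C\,\mathbb E_\nu[\|\nabla f\|^2]$ for all smooth compactly supported $f:\mathbb R^d\to\mathbb R$. The first variation $\delta\mathcal F_0:\mathcal P_2(\mathbb R^d)\times\mathbb R^d\to\mathbb R$ is the linear functional derivative: $\frac{d}{dt}\big|_{t=0^+}\mathcal F_0((1-t)\nu+t\nu')=\int\delta\mathcal F_0(\nu,x)\,(\nu'-\nu)(dx)$ (defined up to an additive constant depending on $\nu$). The second variation $\delta^2\mathcal F_0:\mathcal P_2(\mathbb R^d)\times\mathbb R^d\times\mathbb R^d\to\mathbb R$ is the first variation of $\nu\mapsto\delta\mathcal F_0(\nu,x)$: $\frac{d}{dt}\big|_{t=0^+}\delta\mathcal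 F_0((1-t)\nu+t\nu',x)=\int\delta^2\mathcal F_0(\nu,x,y)\,(\nu'-\nu)(dy)$. $\mathcal F_0$ is assumed regular enough that these variations exist and the usual calculus along linear interpolations applies. $\nabla\delta\mathcal F_0(\nu,x)$ is the gradient in $x$, and $\nabla_1\nabla_2\delta^2\mathcal F_0(\nu,x,y)$ is the $d\times d$ matrix of mixed derivatives in $x$ and $y$. *)

theory Defs
  imports "HOL-Probability.Probability"
begin

definition P2 :: "(real ^ 'd) measure set" where
  "P2 = {\<nu>. prob_space \<nu> \<and> sets \<nu> = sets borel \<and> integrable \<nu> (\<lambda>x. (norm x)\<^sup>2)}"

(* (1 - t) \<nu> + t \<nu>', for 0 \<le> t \<le> 1 *)
definition lin_interp ::
  "real \<Rightarrow> (real ^ 'd) measure \<Rightarrow> (real ^ 'd) measure \<Rightarrow> (real ^ 'd) measure" where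
  "lin_interp t \<nu> \<nu>' =
     measure_of UNIV (sets borel)
       (\<lambda>A. ennreal (1 - t) * emeasure \<nu> A + ennreal t * emeasure \<nu>' A)"

definition avg_measure :: "nat \<Rightarrow> (nat \<Rightarrow> (real ^ 'd) measure) \<Rightarrow> (real ^ 'd) measure" where
  "avg_measure N \<nu> =
     measure_of UNIV (sets borel)
       (\<lambda>A. ennreal (1 / real N) * (\<Sum>i\<in>{1..N}. emeasure (\<nu> i) A))"

definition empirical :: "nat \<Rightarrow> (nat \<Rightarrow> real ^ 'd) \<Rightarrow> (real ^ 'd) measure" where
  "empirical N x = avg_measure N (\<lambda>i. return borel (x i))"

(* The set functions above are measures, so measure_of does not degenerate. *)

lemma emeasure_lin_interp:
  fixes \<nu> \<nu>' :: "(real ^ 'd) measure"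
  assumes "sets \<nu> = sets borel" "sets \<nu>' = sets borel" "A \<in> sets borel"
  shows "emeasure (lin_interp t \<nu> \<nu>') A
           = ennreal (1 - t) * emeasure \<nu> A + ennreal t * emeasure \<nu>' A"
  unfolding lin_interp_def
proof (rule emeasure_measure_of_sigma)
  show "sigma_algebra UNIV (sets (borel :: (real ^ 'd) measure))"
    using sets.sigma_algebra_axioms[of "borel :: (real ^ 'd) measure"] by simp
  show "countably_additive (sets borel)
          (\<lambda>A. ennreal (1 - t) * emeasure \<nu> A + ennreal t * emeasure \<nu>' A)"
  proof (rule countably_additiveI)
    fix F :: "nat \<Rightarrow> (real ^ 'd) set"
    assume F: "range F \<subseteq> sets borel" "disjoint_family F"
    show "(\<Sum>i. ennreal (1 - t) * emeasure \<nu> (F i) + ennreal t * emeasure \<nu>' (F i))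
            = ennreal (1 - t) * emeasure \<nu> (\<Union>i. F i) + ennreal t * emeasure \<nu>' (\<Union>i. F i)"
      using F assms by (simp add: suminf_add[symmetric] suminf_emeasure)
  qed
qed (use assms in \<open>auto simp: positive_def\<close>)

lemma emeasure_avg_measure:
  fixes \<nu> :: "nat \<Rightarrow> (real ^ 'd) measure"
  assumes "\<And>i. i \<in> {1..N} \<Longrightarrow> sets (\<nu> i) = sets borel" "A \<in> sets borel"
  shows "emeasure (avg_measure N \<nu>) A
           = ennreal (1 / real N) * (\<Sum>i\<in>{1..N}. emeasure (\<nu> i) A)"
  unfolding avg_measure_def
proof (rule emeasure_measure_of_sigma)
  show "sigma_algebra UNIV (sets (borel :: (real ^ 'd) measure))"
    using sets.sigma_algebra_axioms[of "borel :: (real ^ 'd) measure"] by simp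
  show "countably_additive (sets borel)
          (\<lambda>A. ennreal (1 / real N) * (\<Sum>i\<in>{1..N}. emeasure (\<nu> i) A))"
  proof (rule countably_additiveI)
    fix F :: "nat \<Rightarrow> (real ^ 'd) set"
    assume F: "range F \<subseteq> sets borel" "disjoint_family F"
    have "(\<Sum>n. \<Sum>i\<in>{1..N}. emeasure (\<nu> i) (F n))
            = (\<Sum>i\<in>{1..N}. \<Sum>n. emeasure (\<nu> i) (F n))"
      by (rule suminf_sum) simp
    also have "\<dots> = (\<Sum>i\<in>{1..N}. emeasure (\<nu> i) (\<Union>n. F n))"
      using F assms by (intro sum.cong suminf_emeasure) auto
    finally show "(\<Sum>n. ennreal (1 / real N) * (\<Sum>i\<in>{1..N}. emeasure (\<nu> i) (F n)))
            = ennreal (1 / real N) * (\<Sum>i\<in>{1..N}. emeasure (\<nu> i) (\<Union>n. F n))"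
      by simp
  qed
qed (use assms in \<open>auto simp: positive_def\<close>)

(* dF \<nu> x is the linear functional derivative of F at \<nu>, evaluated at x. Only the values of F
   and dF on P2 matter, and dF is determined up to an additive constant depending on \<nu>.
   The case \<nu>' = \<nu> gives integrability of dF \<nu> with respect to \<nu> itself. *)
definition first_variation ::
  "((real ^ 'd) measure \<Rightarrow> real) \<Rightarrow> ((real ^ 'd) measure \<Rightarrow> real ^ 'd \<Rightarrow> real) \<Rightarrow> bool" where
  "first_variation F dF \<longleftrightarrow>
     (\<forall>\<nu>\<in>P2. \<forall>\<nu>'\<in>P2. integrable \<nu>' (dF \<nu>) \<and>
        ((\<lambda>t. F (lin_interp t \<nu> \<nu>')) has_real_derivative
           ((\<integral>x. dF \<nu> x \<partial>\<nu>') - (\<integral>x. dF \<nu> x \<partial>\<nu>))) (at_right 0))"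

definition second_variation ::
  "((real ^ 'd) measure \<Rightarrow> real ^ 'd \<Rightarrow> real) \<Rightarrow>
   ((real ^ 'd) measure \<Rightarrow> real ^ 'd \<Rightarrow> real ^ 'd \<Rightarrow> real) \<Rightarrow> bool" where
  "second_variation dF d2F \<longleftrightarrow> (\<forall>x. first_variation (\<lambda>\<nu>. dF \<nu> x) (\<lambda>\<nu>. d2F \<nu> x))"

definition gradient :: "(real ^ 'd \<Rightarrow> real) \<Rightarrow> real ^ 'd \<Rightarrow> real ^ 'd" where
  "gradient f x = (\<chi> i. frechet_derivative f (at x) (axis i 1))"

(* The entry in row i and column j is the derivative of g in x_i and y_j. *)
definition mixed_derivative ::
  "(real ^ 'd \<Rightarrow> real ^ 'd \<Rightarrow> real) \<Rightarrow> real ^ 'd \<Rightarrow> real ^ 'd \<Rightarrow> real ^ 'd ^ 'd" where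
  "mixed_derivative g x y = transpose (jacobian (\<lambda>x'. gradient (g x') y) (at x))"

definition mixed_differentiable :: "(real ^ 'd \<Rightarrow> real ^ 'd \<Rightarrow> real) \<Rightarrow> bool" where
  "mixed_differentiable g \<longleftrightarrow>
     (\<forall>x y. g x differentiable (at y) \<and> (\<lambda>x'. gradient (g x') y) differentiable (at x))"

definition strongly_convex :: "real \<Rightarrow> (real ^ 'd \<Rightarrow> real) \<Rightarrow> bool" where
  "strongly_convex \<alpha> V \<longleftrightarrow>
     (\<forall>x y. \<forall>t\<in>{0..1}. V ((1 - t) *\<^sub>R x + t *\<^sub>R y)
        \<le> (1 - t) * V x + t * V y - \<alpha> / 2 * t * (1 - t) * (norm (x - y))\<^sup>2)"

primrec C_k :: "nat \<Rightarrow> (real ^ 'd \<Rightarrow> real) \<Rightarrow> bool" where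
  "C_k 0 f \<longleftrightarrow> continuous_on UNIV f"
| "C_k (Suc k) f \<longleftrightarrow> f differentiable_on UNIV \<and> (\<forall>i. C_k k (\<lambda>x. gradient f x $ i))"

definition smooth_compact_support :: "(real ^ 'd \<Rightarrow> real) \<Rightarrow> bool" where
  "smooth_compact_support f \<longleftrightarrow> (\<forall>k. C_k k f) \<and> compact (closure {x. f x \<noteq> 0})"

definition poincare :: "real \<Rightarrow> (real ^ 'd) measure \<Rightarrow> bool" where
  "poincare C \<nu> \<longleftrightarrow>
     (\<forall>f. smooth_compact_support f \<longrightarrow>
        (\<integral>x. (f x - (\<integral>y. f y \<partial>\<nu>))\<^sup>2 \<partial>\<nu>) \<le> C * (\<integral>x. (norm (gradient f x))\<^sup>2 \<partial>\<nu>))"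

(* \<nu> is the probability measure with density proportional to f with respect to M; that the
   normalising constant exists, is finite and is positive is part of the condition. *)
definition density_proportional :: "'a measure \<Rightarrow> 'a measure \<Rightarrow> ('a \<Rightarrow> real) \<Rightarrow> bool" where
  "density_proportional \<nu> M f \<longleftrightarrow>
     integrable M f \<and> (\<integral>x. f x \<partial>M) > 0 \<and>
     \<nu> = density M (\<lambda>x. ennreal (f x / (\<integral>x. f x \<partial>M)))"

end

theory Submission
  imports Defs
begin

text \<open>By convexity, \<open>G(x) = (2N/\<sigma>\<^sup>2) (F\<^sub>0(\<rho>\<^sub>x) - F\<^sub>0(\<pi>') - \<integral> \<delta>F\<^sub>0(\<pi>', \<cdot>) d(\<rho>\<^sub>x - \<pi>'))\<close>, with \<open>\<pi>'\<close> the average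
  of the \<open>\<pi>\<^sup>i\<close>, is nonnegative, and \<open>\<mu>\<close> has density proportional to \<open>exp(-G)\<close> with respect to the
  product of the \<open>\<pi>\<^sup>i\<close>. Jensen's inequality bounds the divergence by the mean of \<open>G\<close> under the product,
  which is \<open>2N/\<sigma>\<^sup>2\<close> times \<open>E F\<^sub>0(\<rho>\<^sub>X) - F\<^sub>0(\<pi>')\<close>.

  To bound this difference, replace the laws \<open>\<pi>\<^sup>k\<close> by Dirac masses at independent samples one at a time.
  Each replacement has a first-order effect of mean zero, and the mean value theorem for the second
  variation bounds the remainder by \<open>(\<beta>/N\<^sup>2) \<integral> |X\<^sup>k - y|\<^sup>2 \<pi>\<^sup>k(dy)\<close>, of mean \<open>2 (\<beta>/N\<^sup>2) Var \<pi>\<^sup>k\<close>.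
  The variance is at most \<open>C\<^sub>P\<^sub>I d\<close> by the Poincare inequality for (truncated) coordinate functions,
  and at most \<open>2d/\<alpha> + 4B\<^sup>2/(\<alpha>\<^sup>2 \<sigma>\<^sup>4)\<close> since \<open>\<pi>\<^sup>k\<close> is a Lipschitz perturbation of an
  \<open>\<alpha>\<close>-strongly log-concave measure.\<close>

section \<open>Mixtures of measures\<close>

text \<open>The variations are given only as right derivatives at the start of a segment, with no
  continuity or measurability in the measure argument, so a Taylor formula with integral remainder
  is out of reach. What survives is the mean value theorem, whose intermediate measure depends on
  the points in question; every estimate is therefore uniform over \<open>P2\<close> and pointwise
  in the samples, and is integrated only afterwards. Convexity spares a second expansion of the
  energy: the tangent inequality at the new measure leaves only the change of the first variation to
  control.

  Replacing all samples at once would need the cross terms between independent particles to cancel,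
  which an intermediate measure depending on every sample destroys. When a single particle is
  inserted, the first-order term is taken at a measure that does not involve it, so its conditional
  mean is zero. There remain N remainders of size 1/N^2, which the prefactor N turns into a bound
  free of N.\<close>

lemma nn_integral_mixture:
  fixes c :: "'i \<Rightarrow> real"
  assumes "finite I"
    and sets_M: "\<And>i. i \<in> I \<Longrightarrow> sets (M i) = sets \<nu>"
    and mix: "\<And>A. A \<in> sets \<nu> \<Longrightarrow> emeasure \<nu> A = (\<Sum>i\<in>I. ennreal (c i) * emeasure (M i) A)"
    and f: "f \<in> borel_measurable \<nu>"
  shows "(\<integral>\<^sup>+x. f x \<partial>\<nu>) = (\<Sum>i\<in>I. ennreal (c i) * (\<integral>\<^sup>+x. f x \<partial>M i))"
  using f
proof (induction rule: borel_measurable_induct)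
  case (cong f g)
  have "(\<integral>\<^sup>+x. f x \<partial>M i) = (\<integral>\<^sup>+x. g x \<partial>M i)" if "i \<in> I" for i
    using cong(3) sets_eq_imp_space_eq[OF sets_M[OF that]] by (intro nn_integral_cong) auto
  moreover have "(\<integral>\<^sup>+x. f x \<partial>\<nu>) = (\<integral>\<^sup>+x. g x \<partial>\<nu>)"
    using cong(3) by (rule nn_integral_cong)
  ultimately show ?case using cong(4) by simp
next
  case (set A)
  then show ?case using mix sets_M by simp
next
  case (mult u a)
  have "(\<integral>\<^sup>+x. a * u x \<partial>M i) = a * (\<integral>\<^sup>+x. u x \<partial>M i)" if "i \<in> I" for i
    using mult(2) by (intro nn_integral_cmult) (simp cong: measurable_cong_sets add: sets_M[OF that])
  then show ?case
    using mult by (simp add: nn_integral_cmult sum_distrib_left mult.left_commute)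
next
  case (add u v)
  have "(\<integral>\<^sup>+x. v x + u x \<partial>M i) = (\<integral>\<^sup>+x. v x \<partial>M i) + (\<integral>\<^sup>+x. u x \<partial>M i)" if "i \<in> I" for i
    using add by (intro nn_integral_add) (simp_all cong: measurable_cong_sets add: sets_M[OF that])
  then show ?case
    using add by (simp add: nn_integral_add sum.distrib distrib_left)
next
  case (seq U)
  have lim: "(\<lambda>n. \<integral>\<^sup>+x. U n x \<partial>M') \<longlonglongrightarrow> (\<integral>\<^sup>+x. (SUP n. U n) x \<partial>M')"
    if "sets M' = sets \<nu>" for M'
  proof (rule nn_integral_LIMSEQ)
    show "incseq U" by fact
    show "U n \<in> borel_measurable M'" for n
      using seq(1)[of n] by (simp cong: measurable_cong_sets add: that)
    show "(\<lambda>n. U n x) \<longlonglongrightarrow> (SUP n. U n) x" for x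
      using LIMSEQ_SUP[of "\<lambda>n. U n x"] \<open>incseq U\<close> by (simp add: incseq_def le_fun_def image_image)
  qed
  have "(\<lambda>n. \<Sum>i\<in>I. ennreal (c i) * (\<integral>\<^sup>+x. U n x \<partial>M i))
          \<longlonglongrightarrow> (\<Sum>i\<in>I. ennreal (c i) * (\<integral>\<^sup>+x. (SUP n. U n) x \<partial>M i))"
    by (intro tendsto_sum ennreal_tendsto_cmult lim sets_M) auto
  then have "(\<lambda>n. \<integral>\<^sup>+x. U n x \<partial>\<nu>)
          \<longlonglongrightarrow> (\<Sum>i\<in>I. ennreal (c i) * (\<integral>\<^sup>+x. (SUP n. U n) x \<partial>M i))"
    by (simp add: seq)
  with lim[OF refl] show ?case by (rule LIMSEQ_unique)
qed

text \<open>Averages and interpolations are both finite mixtures, known only through their values on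
  sets; this handles integration against either of them at once. The signed case splits f into
  \<open>max 0 (f x)\<close> and \<open>max 0 (- f x)\<close>.\<close>

lemma integral_mixture:
  fixes c :: "'i \<Rightarrow> real" and f :: "'a \<Rightarrow> real"
  assumes "finite I"
    and sets_M: "\<And>i. i \<in> I \<Longrightarrow> sets (M i) = sets \<nu>"
    and mix: "\<And>A. A \<in> sets \<nu> \<Longrightarrow> emeasure \<nu> A = (\<Sum>i\<in>I. ennreal (c i) * emeasure (M i) A)"
    and c: "\<And>i. i \<in> I \<Longrightarrow> c i \<ge> 0"
    and f: "\<And>i. i \<in> I \<Longrightarrow> integrable (M i) f" "f \<in> borel_measurable \<nu>"
  shows "integrable \<nu> f" "(\<integral>x. f x \<partial>\<nu>) = (\<Sum>i\<in>I. c i * (\<integral>x. f x \<partial>M i))"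
proof -
  note [measurable] = f(2)
  have pos: "integrable \<nu> g \<and> (\<integral>x. g x \<partial>\<nu>) = (\<Sum>i\<in>I. c i * (\<integral>x. g x \<partial>M i))"
    if g: "\<And>i. i \<in> I \<Longrightarrow> integrable (M i) g" "g \<in> borel_measurable \<nu>" "\<And>x. g x \<ge> 0"
    for g :: "'a \<Rightarrow> real"
  proof -
    have nn: "(\<integral>\<^sup>+x. ennreal (g x) \<partial>M i) = ennreal (\<integral>x. g x \<partial>M i)" if "i \<in> I" for i
      using g that by (intro nn_integral_eq_integral) auto
    have nonneg: "(\<integral>x. g x \<partial>M i) \<ge> 0" for i
      using g by (intro integral_nonneg_AE) auto
    have "(\<integral>\<^sup>+x. ennreal (g x) \<partial>\<nu>) = (\<Sum>i\<in>I. ennreal (c i) * (\<integral>\<^sup>+x. ennreal (g x) \<partial>M i))"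
      using g by (intro nn_integral_mixture assms) auto
    also have "\<dots> = (\<Sum>i\<in>I. ennreal (c i * (\<integral>x. g x \<partial>M i)))"
      using nn c nonneg by (intro sum.cong) (auto simp: ennreal_mult)
    also have "\<dots> = ennreal (\<Sum>i\<in>I. c i * (\<integral>x. g x \<partial>M i))"
      using c nonneg by (intro sum_ennreal) auto
    finally have *: "(\<integral>\<^sup>+x. ennreal (g x) \<partial>\<nu>) = ennreal (\<Sum>i\<in>I. c i * (\<integral>x. g x \<partial>M i))" .
    have "integrable \<nu> g"
      using g * by (intro integrableI_nonneg) auto
    moreover have "(\<integral>x. g x \<partial>\<nu>) = (\<Sum>i\<in>I. c i * (\<integral>x. g x \<partial>M i))"
      using g * sum_nonneg[of I "\<lambda>i. c i * (\<integral>x. g x \<partial>M i)"] c nonneg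
      by (subst integral_eq_nn_integral) auto
    ultimately show ?thesis by simp
  qed
  have 1: "integrable \<nu> (\<lambda>x. max 0 (f x)) \<and>
      (\<integral>x. max 0 (f x) \<partial>\<nu>) = (\<Sum>i\<in>I. c i * (\<integral>x. max 0 (f x) \<partial>M i))"
    using f by (intro pos) auto
  have 2: "integrable \<nu> (\<lambda>x. max 0 (- f x)) \<and>
      (\<integral>x. max 0 (- f x) \<partial>\<nu>) = (\<Sum>i\<in>I. c i * (\<integral>x. max 0 (- f x) \<partial>M i))"
    using f by (intro pos) auto
  have eq: "f = (\<lambda>x. max 0 (f x) - max 0 (- f x))"
    by auto
  show "integrable \<nu> f"
    using 1 2 by (subst eq) auto
  have "(\<integral>x. f x \<partial>M i) = (\<integral>x. max 0 (f x) \<partial>M i) - (\<integral>x. max 0 (- f x) \<partial>M i)" if "i \<in> I" for i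
    using f that by (subst eq) (intro Bochner_Integration.integral_diff; auto)
  moreover have "(\<integral>x. f x \<partial>\<nu>) = (\<integral>x. max 0 (f x) \<partial>\<nu>) - (\<integral>x. max 0 (- f x) \<partial>\<nu>)"
    using 1 2 by (subst eq) (intro Bochner_Integration.integral_diff; auto)
  ultimately show "(\<integral>x. f x \<partial>\<nu>) = (\<Sum>i\<in>I. c i * (\<integral>x. f x \<partial>M i))"
    using 1 2 by (simp add: right_diff_distrib sum_subtractf)
qed

lemma P2D:
  assumes "\<nu> \<in> P2"
  shows "prob_space \<nu>" "sets \<nu> = sets borel" "integrable \<nu> (\<lambda>x. (norm x)\<^sup>2)" "space \<nu> = UNIV"
  using assms sets_eq_imp_space_eq[of \<nu> borel] by (auto simp: P2_def)

lemma P2_mixture: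
  fixes c :: "'i \<Rightarrow> real" and \<nu> :: "(real ^ 'd) measure"
  assumes "finite I" and M: "\<And>i. i \<in> I \<Longrightarrow> M i \<in> P2"
    and \<nu>: "sets \<nu> = sets borel"
    and mix: "\<And>A. A \<in> sets \<nu> \<Longrightarrow> emeasure \<nu> A = (\<Sum>i\<in>I. ennreal (c i) * emeasure (M i) A)"
    and c: "\<And>i. i \<in> I \<Longrightarrow> c i \<ge> 0" "(\<Sum>i\<in>I. c i) = 1"
  shows "\<nu> \<in> P2"
proof -
  have [measurable_cong]: "sets \<nu> = sets borel" by fact
  have "emeasure \<nu> (space \<nu>) = (\<Sum>i\<in>I. ennreal (c i) * emeasure (M i) UNIV)"
    using mix sets_eq_imp_space_eq[OF \<nu>] by simp
  also have "\<dots> = (\<Sum>i\<in>I. ennreal (c i))"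
    using P2D[OF M] prob_space.emeasure_space_1[of "M _"] by (intro sum.cong) (auto, metis mult.right_neutral)
  also have "\<dots> = 1"
    using c by (simp add: sum_ennreal)
  finally have "prob_space \<nu>" by (rule prob_spaceI)
  moreover have "integrable \<nu> (\<lambda>x. (norm x)\<^sup>2)"
    using P2D[OF M] \<nu> by (intro integral_mixture(1)[OF \<open>finite I\<close> _ mix c(1)]) auto
  ultimately show ?thesis using \<nu> by (simp add: P2_def)
qed

lemma sets_lin_interp [simp]: "sets (lin_interp t \<nu> \<nu>') = sets (borel :: (real ^ 'd) measure)"
  unfolding lin_interp_def by (metis sets.sets_measure_of_eq space_borel)

lemma sets_avg_measure [simp]: "sets (avg_measure N \<nu>) = sets (borel :: (real ^ 'd) measure)"
  unfolding avg_measure_def by (metis sets.sets_measure_of_eq space_borel)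

text \<open>Indexed by the two truth values so that the mixture lemmas apply.\<close>

lemma lin_interp_mixture:
  assumes "sets \<nu> = sets borel" "sets \<nu>' = sets borel" "A \<in> sets (lin_interp t \<nu> \<nu>')"
  shows "emeasure (lin_interp t \<nu> \<nu>') A =
    (\<Sum>b\<in>UNIV. ennreal (if b then t else 1 - t) * emeasure (if b then \<nu>' else \<nu>) A)"
  using assms by (simp add: emeasure_lin_interp UNIV_bool add.commute)

lemma lin_interp_in_P2:
  assumes "\<nu> \<in> P2" "\<nu>' \<in> P2" "t \<in> {0..1}"
  shows "lin_interp t \<nu> \<nu>' \<in> P2"
proof (rule P2_mixture[OF _ _ _ lin_interp_mixture])
  show "(\<Sum>b\<in>UNIV. if b then t else 1 - t) = 1" by (simp add: UNIV_bool)
qed (use assms in \<open>auto dest: P2D split: if_splits\<close>)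

lemma integral_lin_interp:
  fixes f :: "real ^ 'd \<Rightarrow> real"
  assumes \<nu>: "\<nu> \<in> P2" "\<nu>' \<in> P2" "t \<in> {0..1}" and f: "integrable \<nu> f" "integrable \<nu>' f"
  shows "(\<integral>x. f x \<partial>lin_interp t \<nu> \<nu>') = (1 - t) * (\<integral>x. f x \<partial>\<nu>) + t * (\<integral>x. f x \<partial>\<nu>')"
proof -
  have "f \<in> borel_measurable \<nu>" using f by simp
  then have f_borel: "f \<in> borel_measurable borel"
    using P2D(2)[OF \<nu>(1)] by (simp cong: measurable_cong_sets)
  have "(\<integral>x. f x \<partial>lin_interp t \<nu> \<nu>') =
    (\<Sum>b\<in>UNIV. (if b then t else 1 - t) * (\<integral>x. f x \<partial>(if b then \<nu>' else \<nu>)))"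
    using \<nu> f f_borel
    by (intro integral_mixture(2) lin_interp_mixture)
       (auto dest: P2D split: if_splits cong: measurable_cong_sets)
  then show ?thesis by (simp add: UNIV_bool)
qed

lemma ennreal_affine:
  fixes a b c :: real and x :: ennreal
  assumes "a \<ge> 0" "b \<ge> 0" "c \<ge> 0" "c = a + b"
  shows "ennreal a * x + ennreal b * x = ennreal c * x"
  using assms by (simp add: ennreal_plus flip: distrib_right)

text \<open>Interpolating further from an intermediate point towards the end point only
  reparametrises the same segment. This carries derivative information at time 0 to interior
  times.\<close>

lemma lin_interp_right:
  assumes \<nu>: "\<nu> \<in> P2" "\<nu>' \<in> P2" and t: "t \<in> {0..1}" and s: "s \<in> {0..1}"
  shows "lin_interp s (lin_interp t \<nu> \<nu>') \<nu>' = lin_interp (t + s * (1 - t)) \<nu> \<nu>'"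
proof (rule measure_eqI)
  fix A assume "A \<in> sets (lin_interp s (lin_interp t \<nu> \<nu>') \<nu>')"
  then have A: "A \<in> sets borel" by simp
  have "ennreal (1 - s) * (ennreal (1 - t) * emeasure \<nu> A + ennreal t * emeasure \<nu>' A)
        + ennreal s * emeasure \<nu>' A
      = ennreal ((1 - s) * (1 - t)) * emeasure \<nu> A
        + (ennreal ((1 - s) * t) * emeasure \<nu>' A + ennreal s * emeasure \<nu>' A)"
    using t s by (simp add: ennreal_mult distrib_left mult.assoc add.assoc)
  also have "ennreal ((1 - s) * t) * emeasure \<nu>' A + ennreal s * emeasure \<nu>' A
      = ennreal (t + s * (1 - t)) * emeasure \<nu>' A"
    using t s mult_left_le_one_le[of t s] by (intro ennreal_affine) (auto simp: algebra_simps)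
  also have "(1 - s) * (1 - t) = 1 - (t + s * (1 - t))"
    by (simp add: algebra_simps)
  finally show "emeasure (lin_interp s (lin_interp t \<nu> \<nu>') \<nu>') A
      = emeasure (lin_interp (t + s * (1 - t)) \<nu> \<nu>') A"
    using \<nu> A by (simp add: emeasure_lin_interp P2D)
qed simp

lemma lin_interp_commute:
  assumes "\<nu> \<in> P2" "\<nu>' \<in> P2"
  shows "lin_interp t \<nu> \<nu>' = lin_interp (1 - t) \<nu>' \<nu>"
  using assms by (intro measure_eqI) (simp_all add: emeasure_lin_interp P2D add.commute)

lemma lin_interp_left:
  assumes \<nu>: "\<nu> \<in> P2" "\<nu>' \<in> P2" and t: "t \<in> {0..1}" and s: "s \<in> {0..1}"
  shows "lin_interp s (lin_interp t \<nu> \<nu>') \<nu> = lin_interp (t - s * t) \<nu> \<nu>'"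
proof -
  have "lin_interp s (lin_interp t \<nu> \<nu>') \<nu> = lin_interp s (lin_interp (1 - t) \<nu>' \<nu>) \<nu>"
    using \<nu> by (subst lin_interp_commute) auto
  also have "\<dots> = lin_interp (1 - t + s * (1 - (1 - t))) \<nu>' \<nu>"
    using t by (intro lin_interp_right \<nu> s) auto
  also have "\<dots> = lin_interp (1 - (t - s * t)) \<nu>' \<nu>" by (simp add: algebra_simps)
  also have "\<dots> = lin_interp (t - s * t) \<nu> \<nu>'"
    using \<nu> by (subst lin_interp_commute) auto
  finally show ?thesis .
qed

lemma lin_interp_0 [simp]: "\<nu> \<in> P2 \<Longrightarrow> \<nu>' \<in> P2 \<Longrightarrow> lin_interp 0 \<nu> \<nu>' = \<nu>"
  by (intro measure_eqI) (simp_all add: emeasure_lin_interp P2D)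

lemma lin_interp_1 [simp]: "\<nu> \<in> P2 \<Longrightarrow> \<nu>' \<in> P2 \<Longrightarrow> lin_interp 1 \<nu> \<nu>' = \<nu>'"
  by (intro measure_eqI) (simp_all add: emeasure_lin_interp P2D)

lemma return_in_P2: "return borel x \<in> P2"
proof -
  have "integrable (return borel x) (\<lambda>x. (norm x)\<^sup>2)"
    by (rule integrableI_bounded) (auto simp: nn_integral_return)
  then show ?thesis by (auto simp: P2_def prob_space_return)
qed

lemma avg_measure_mixture:
  assumes "\<And>i. i \<in> {1..N} \<Longrightarrow> \<nu> i \<in> P2" "A \<in> sets (avg_measure N \<nu>)"
  shows "emeasure (avg_measure N \<nu>) A = (\<Sum>i\<in>{1..N}. ennreal (1 / real N) * emeasure (\<nu> i) A)"
  using assms by (subst emeasure_avg_measure) (auto simp: P2D sum_distrib_left)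

lemma avg_measure_in_P2:
  assumes "N \<ge> 1" "\<And>i. i \<in> {1..N} \<Longrightarrow> \<nu> i \<in> P2"
  shows "avg_measure N \<nu> \<in> P2"
  using assms by (intro P2_mixture[OF _ _ _ avg_measure_mixture]) auto

lemma integral_avg_measure:
  fixes f :: "real ^ 'd \<Rightarrow> real"
  assumes \<nu>: "\<And>i. i \<in> {1..N} \<Longrightarrow> \<nu> i \<in> P2" and f: "\<And>i. i \<in> {1..N} \<Longrightarrow> integrable (\<nu> i) f"
    "f \<in> borel_measurable borel"
  shows "(\<integral>x. f x \<partial>avg_measure N \<nu>) = (\<Sum>i\<in>{1..N}. (\<integral>x. f x \<partial>\<nu> i)) / real N"
proof -
  have "(\<integral>x. f x \<partial>avg_measure N \<nu>) = (\<Sum>i\<in>{1..N}. (1 / real N) * (\<integral>x. f x \<partial>\<nu> i))"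
    using \<nu> f
    by (intro integral_mixture(2) avg_measure_mixture) (auto simp: P2D cong: measurable_cong_sets)
  then show ?thesis by (simp add: sum_divide_distrib)
qed

section \<open>Calculus along linear interpolations\<close>

lemma first_variationD:
  assumes "first_variation F dF" "\<nu> \<in> P2" "\<nu>' \<in> P2"
  shows "integrable \<nu>' (dF \<nu>)"
    "((\<lambda>t. F (lin_interp t \<nu> \<nu>')) has_real_derivative
           ((\<integral>x. dF \<nu> x \<partial>\<nu>') - (\<integral>x. dF \<nu> x \<partial>\<nu>))) (at_right 0)"
  using assms unfolding first_variation_def by blast+

text \<open>The one-sided derivatives at an interior time are the right derivatives at 0 of the
  interpolations from the intermediate measure to either end point; they agree.\<close>

lemma has_derivative_along_lin_interp:
  assumes F: "first_variation F dF" and \<nu>: "\<nu> \<in> P2" "\<nu>' \<in> P2" and t: "t \<in> {0..1}"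
  defines "D \<equiv> (\<integral>x. dF (lin_interp t \<nu> \<nu>') x \<partial>\<nu>') - (\<integral>x. dF (lin_interp t \<nu> \<nu>') x \<partial>\<nu>)"
  shows "((\<lambda>t. F (lin_interp t \<nu> \<nu>')) has_real_derivative D) (at t within {0..1})"
proof -
  define \<rho> where "\<rho> = lin_interp t \<nu> \<nu>'"
  have \<rho>: "\<rho> \<in> P2" unfolding \<rho>_def by (intro lin_interp_in_P2 \<nu> t)
  \<comment> \<open>Because \<rho> is itself a mixture, the right derivatives at 0 towards
    \<open>\<nu>'\<close> and towards \<open>\<nu>\<close> come out as (1 - t) D and - t D; the time
    rescalings by 1 / (1 - t) and - 1 / t turn both into D.\<close>
  have int: "(\<integral>x. dF \<rho> x \<partial>\<rho>) = (1 - t) * (\<integral>x. dF \<rho> x \<partial>\<nu>) + t * (\<integral>x. dF \<rho> x \<partial>\<nu>')"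
    unfolding \<rho>_def using first_variationD(1)[OF F \<rho>] \<nu>
    by (intro integral_lin_interp \<nu> t) (auto simp: \<rho>_def)
  have D: "D = (\<integral>x. dF \<rho> x \<partial>\<nu>') - (\<integral>x. dF \<rho> x \<partial>\<nu>)"
    by (simp add: D_def \<rho>_def)
  define Q where "Q r = (F (lin_interp r \<nu> \<nu>') - F \<rho>) / (r - t)" for r
  have right: "(Q \<longlongrightarrow> D) (at t within {t..1})"
  \<comment> \<open>At \<open>t = 1\<close> the interval to the right is a single point, so the
    limit is vacuous; likewise on the left at \<open>t = 0\<close>.\<close>
  proof (cases "t = 1")
    case False
    with t have t1: "1 - t > 0" by auto
    define q where "q s = (F (lin_interp s \<rho> \<nu>') - F \<rho>) / s" for s
    have "((\<lambda>s. (F (lin_interp s \<rho> \<nu>') - F (lin_interp 0 \<rho> \<nu>')) / (s - 0)) \<longlongrightarrow>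
            (\<integral>x. dF \<rho> x \<partial>\<nu>') - (\<integral>x. dF \<rho> x \<partial>\<rho>)) (at_right 0)"
      using first_variationD(2)[OF F \<rho> \<nu>(2)] unfolding has_field_derivative_iff .
    then have q: "(q \<longlongrightarrow> (1 - t) * D) (at_right 0)"
      using \<rho> \<nu> by (simp add: q_def[abs_def] int D algebra_simps)
    have "filterlim (\<lambda>r. (r - t) / (1 - t)) (at_right 0) (at t within {t..1})"
    proof (rule filterlim_at[THEN iffD2], intro conjI)
      show "((\<lambda>r. (r - t) / (1 - t)) \<longlongrightarrow> 0) (at t within {t..1})"
        using t1 by (auto intro!: tendsto_eq_intros)
      show "\<forall>\<^sub>F r in at t within {t..1}. (r - t) / (1 - t) \<in> {0<..} \<and> (r - t) / (1 - t) \<noteq> 0"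
        using t1 by (auto simp: eventually_at_filter)
    qed
    from filterlim_compose[OF q this]
    have "((\<lambda>r. q ((r - t) / (1 - t)) / (1 - t)) \<longlongrightarrow> (1 - t) * D / (1 - t)) (at t within {t..1})"
      using t1 by (intro tendsto_intros) auto
    moreover have "\<forall>\<^sub>F r in at t within {t..1}. q ((r - t) / (1 - t)) / (1 - t) = Q r"
    proof (unfold eventually_at_filter, intro always_eventually allI impI)
      fix r assume r: "r \<noteq> t" "r \<in> {t..1}"
      define s where "s = (r - t) / (1 - t)"
      have rs: "r = t + s * (1 - t)" using t1 by (simp add: s_def)
      have s: "s \<in> {0..1}" using r t1 by (auto simp: s_def field_simps)
      have "F (lin_interp s \<rho> \<nu>') = F (lin_interp r \<nu> \<nu>')"
        unfolding \<rho>_def rs using lin_interp_right[OF \<nu> t s] by simp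
      then show "q ((r - t) / (1 - t)) / (1 - t) = Q r"
        using t1 by (simp add: q_def Q_def s_def[symmetric]) (simp add: s_def)
    qed
    ultimately show ?thesis
      using t1 by (simp add: tendsto_cong[OF _] filterlim_cong[OF refl refl])
  qed (simp add: at_within_def)
  have left: "(Q \<longlongrightarrow> D) (at t within {0..t})"
  proof (cases "t = 0")
    case False
    with t have t0: "t > 0" by auto
    define q where "q s = (F (lin_interp s \<rho> \<nu>) - F \<rho>) / s" for s
    have "((\<lambda>s. (F (lin_interp s \<rho> \<nu>) - F (lin_interp 0 \<rho> \<nu>)) / (s - 0)) \<longlongrightarrow>
            (\<integral>x. dF \<rho> x \<partial>\<nu>) - (\<integral>x. dF \<rho> x \<partial>\<rho>)) (at_right 0)"
      using first_variationD(2)[OF F \<rho> \<nu>(1)] unfolding has_field_derivative_iff .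
    then have q: "(q \<longlongrightarrow> - t * D) (at_right 0)"
      using \<rho> \<nu> by (simp add: q_def[abs_def] int D algebra_simps)
    have "filterlim (\<lambda>r. (t - r) / t) (at_right 0) (at t within {0..t})"
    proof (rule filterlim_at[THEN iffD2], intro conjI)
      show "((\<lambda>r. (t - r) / t) \<longlongrightarrow> 0) (at t within {0..t})"
        using t0 by (auto intro!: tendsto_eq_intros)
      show "\<forall>\<^sub>F r in at t within {0..t}. (t - r) / t \<in> {0<..} \<and> (t - r) / t \<noteq> 0"
        using t0 by (auto simp: eventually_at_filter)
    qed
    from filterlim_compose[OF q this]
    have "((\<lambda>r. q ((t - r) / t) / (- t)) \<longlongrightarrow> - t * D / (- t)) (at t within {0..t})"
      using t0 by (intro tendsto_intros) auto
    moreover have "\<forall>\<^sub>F r in at t within {0..t}. q ((t - r) / t) / (- t) = Q r"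
    proof (unfold eventually_at_filter, intro always_eventually allI impI)
      fix r assume r: "r \<noteq> t" "r \<in> {0..t}"
      define s where "s = (t - r) / t"
      have rs: "r = t - s * t" using t0 by (simp add: s_def)
      have s: "s \<in> {0..1}" using r t0 by (auto simp: s_def field_simps)
      have "F (lin_interp s \<rho> \<nu>) = F (lin_interp r \<nu> \<nu>')"
        unfolding \<rho>_def rs using lin_interp_left[OF \<nu> t s] by simp
      moreover have "r - t = - (s * t)" by (simp add: rs)
      ultimately show "q ((t - r) / t) / (- t) = Q r"
        unfolding q_def Q_def s_def[symmetric] by simp
    qed
    ultimately show ?thesis
      using t0 by (simp add: filterlim_cong[OF refl refl])
  qed (simp add: at_within_def)
  have "{0..1} = {0..t} \<union> {t..1}" using t by auto
  with left right have "(Q \<longlongrightarrow> D) (at t within {0..1})"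
    by (simp add: at_within_union filterlim_sup)
  then show ?thesis
    by (simp add: has_field_derivative_iff Q_def[abs_def] \<rho>_def)
qed

text \<open>Only membership in \<open>P2\<close> is kept of the intermediate measure, because the
  bounds on the variations are uniform there.\<close>

lemma mvt_lin_interp:
  assumes F: "first_variation F dF" and \<nu>: "\<nu> \<in> P2" "\<nu>' \<in> P2"
  obtains \<rho> where "\<rho> \<in> P2" "F \<nu>' - F \<nu> = (\<integral>x. dF \<rho> x \<partial>\<nu>') - (\<integral>x. dF \<rho> x \<partial>\<nu>)"
proof -
  have "\<exists>t\<in>{0<..<1::real}. F (lin_interp 1 \<nu> \<nu>') - F (lin_interp 0 \<nu> \<nu>') =
      ((\<integral>x. dF (lin_interp t \<nu> \<nu>') x \<partial>\<nu>') - (\<integral>x. dF (lin_interp t \<nu> \<nu>') x \<partial>\<nu>)) * (1 - 0)"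
    using has_derivative_along_lin_interp[OF F \<nu>]
    by (intro mvt_simple) (auto simp: has_field_derivative_def)
  then obtain t where t: "t \<in> {0<..<1}" "F (lin_interp 1 \<nu> \<nu>') - F (lin_interp 0 \<nu> \<nu>') =
      ((\<integral>x. dF (lin_interp t \<nu> \<nu>') x \<partial>\<nu>') - (\<integral>x. dF (lin_interp t \<nu> \<nu>') x \<partial>\<nu>))"
    by auto
  show ?thesis
    by (rule that[of "lin_interp t \<nu> \<nu>'"]) (use t \<nu> in \<open>auto intro!: lin_interp_in_P2\<close>)
qed

text \<open>By convexity every difference quotient at the start of the segment is at most the full
  increment, and the limit inherits this. It serves twice: for the sign of the Gibbs exponent, and
  with the end points swapped to bound an increment of the energy from above.\<close>

lemma convex_first_variation_le:
  assumes F: "first_variation F dF" and \<nu>: "\<nu> \<in> P2" "\<nu>' \<in> P2"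
    and conv: "\<And>t. t \<in> {0..1} \<Longrightarrow> F (lin_interp t \<nu> \<nu>') \<le> (1 - t) * F \<nu> + t * F \<nu>'"
  shows "(\<integral>x. dF \<nu> x \<partial>\<nu>') - (\<integral>x. dF \<nu> x \<partial>\<nu>) \<le> F \<nu>' - F \<nu>"
proof (rule tendsto_upperbound)
  show "((\<lambda>t. (F (lin_interp t \<nu> \<nu>') - F (lin_interp 0 \<nu> \<nu>')) / (t - 0)) \<longlongrightarrow>
            (\<integral>x. dF \<nu> x \<partial>\<nu>') - (\<integral>x. dF \<nu> x \<partial>\<nu>)) (at_right 0)"
    using first_variationD(2)[OF F \<nu>] unfolding has_field_derivative_iff .
  have "\<forall>\<^sub>F t in at_right (0::real). t \<in> {0<..<1}"
    by (rule eventually_at_right_real) simp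
  then show "\<forall>\<^sub>F t in at_right 0. (F (lin_interp t \<nu> \<nu>') - F (lin_interp 0 \<nu> \<nu>')) / (t - 0) \<le> F \<nu>' - F \<nu>"
  proof eventually_elim
    case (elim t)
    with conv[of t] show ?case using \<nu> by (simp add: field_simps)
  qed
qed simp

section \<open>Gradients and mixed derivatives\<close>

lemma frechet_derivative_eq_gradient:
  fixes f :: "real ^ 'd \<Rightarrow> real"
  assumes "f differentiable (at x)"
  shows "frechet_derivative f (at x) v = gradient f x \<bullet> v"
proof -
  have lin: "linear (frechet_derivative f (at x))"
    using assms by (rule linear_frechet_derivative)
  have "frechet_derivative f (at x) (\<Sum>i\<in>UNIV. v $ i *\<^sub>R axis i 1)
      = (\<Sum>i\<in>UNIV. v $ i *\<^sub>R frechet_derivative f (at x) (axis i 1))"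
    by (simp add: linear_sum[OF lin] linear_cmul[OF lin])
  also have "(\<Sum>i\<in>UNIV. v $ i *\<^sub>R axis i 1) = v"
    using basis_expansion[of v] by (simp add: scalar_mult_eq_scaleR)
  finally show ?thesis by (simp add: gradient_def inner_vec_def mult.commute)
qed

lemma has_derivative_gradient:
  fixes f :: "real ^ 'd \<Rightarrow> real"
  assumes "f differentiable (at x)"
  shows "(f has_derivative (\<lambda>h. gradient f x \<bullet> h)) (at x)"
proof -
  have "frechet_derivative f (at x) = (\<lambda>h. gradient f x \<bullet> h)"
    using frechet_derivative_eq_gradient[OF assms] by blast
  with assms show ?thesis by (metis frechet_derivative_works)
qed

lemma gradient_eqI:
  fixes f :: "real ^ 'd \<Rightarrow> real"
  assumes "(f has_derivative (\<lambda>h. g \<bullet> h)) (at x)"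
  shows "gradient f x = g"
  using frechet_derivative_at[OF assms, symmetric]
  by (simp add: gradient_def vec_eq_iff inner_axis)

lemma lipschitz_gradient_bound:
  fixes f :: "real ^ 'd \<Rightarrow> real"
  assumes "\<And>x. f differentiable (at x)" "\<And>x. norm (gradient f x) \<le> K"
  shows "\<bar>f x - f y\<bar> \<le> K * norm (x - y)"
proof -
  have "norm (f x - f y) \<le> K * norm (x - y)"
  proof (rule differentiable_bound[of UNIV])
    show "onorm (\<lambda>h. gradient f z \<bullet> h) \<le> K" for z
      using order_trans[OF Cauchy_Schwarz_ineq2 mult_right_mono[OF assms(2) norm_ge_zero]]
      by (intro onorm_le) simp
  qed (use has_derivative_gradient[OF assms(1)] in auto)
  then show ?thesis by simp
qed

text \<open>\<open>mixed_derivative\<close> is a transposed Jacobian, so its bound has to be passed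
  to the Jacobian itself. This goes through |A h|^2 = <A^T A h, h> <= K |A h| |h|.\<close>

lemma norm_mul_vec_le_transpose:
  fixes A :: "real ^ 'n ^ 'n"
  assumes "onorm ((*v) (transpose A)) \<le> K"
  shows "norm (A *v h) \<le> K * norm h"
proof (cases "A *v h = 0")
  case True
  have "0 \<le> K" using onorm_pos_le[OF matrix_vector_mul_bounded_linear] assms by (rule order_trans)
  with True show ?thesis by simp
next
  case False
  have "(norm (A *v h))\<^sup>2 = (transpose A *v (A *v h)) \<bullet> h"
    by (simp add: dot_square_norm dot_lmul_matrix transpose_matrix_vector flip: power2_norm_eq_inner)
  also have "\<dots> \<le> norm (transpose A *v (A *v h)) * norm h"
    by (rule norm_cauchy_schwarz)
  also have "\<dots> \<le> K * norm (A *v h) * norm h"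
    by (intro mult_right_mono norm_ge_zero order_trans[OF onorm[OF matrix_vector_mul_bounded_linear]] assms)
  finally have "norm (A *v h) * norm (A *v h) \<le> norm (A *v h) * (K * norm h)"
    by (simp add: power2_eq_square mult_ac)
  with False show ?thesis by (subst (asm) mult_le_cancel_left_pos) auto
qed

text \<open>Two mean value inequalities, one per variable: the gradient of \<open>g x - g y\<close>
  in the second variable is a difference of gradients at x and y, at most K |x - y| by the Jacobian
  in the first variable; this is then a Lipschitz constant in the second.\<close>

lemma mixed_difference_bound:
  fixes g :: "real ^ 'd \<Rightarrow> real ^ 'd \<Rightarrow> real"
  assumes g: "mixed_differentiable g"
    and K: "\<And>x y. onorm ((*v) (mixed_derivative g x y)) \<le> K"
  shows "\<bar>(g x z - g y z) - (g x z' - g y z')\<bar> \<le> K * norm (x - y) * norm (z - z')"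
proof (rule lipschitz_gradient_bound)
  have diff: "g u differentiable (at w)" "(\<lambda>u'. gradient (g u') w) differentiable (at u)" for u w
    using g by (auto simp: mixed_differentiable_def)
  fix w
  show "(\<lambda>w. g x w - g y w) differentiable (at w)"
    by (intro derivative_intros diff)
  have "((\<lambda>w. g x w - g y w) has_derivative (\<lambda>h. gradient (g x) w \<bullet> h - gradient (g y) w \<bullet> h)) (at w)"
    by (intro derivative_intros has_derivative_gradient diff)
  then have "gradient (\<lambda>w. g x w - g y w) w = gradient (g x) w - gradient (g y) w"
    by (intro gradient_eqI) (simp add: inner_diff_left)
  moreover have "norm (gradient (g x) w - gradient (g y) w) \<le> K * norm (x - y)"
  proof (rule differentiable_bound[of UNIV])
    fix u
    show "((\<lambda>u. gradient (g u) w) has_derivative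
        (\<lambda>h. jacobian (\<lambda>u. gradient (g u) w) (at u) *v h)) (at u within UNIV)"
      using diff(2)[of w u] by (simp add: jacobian_works)
    show "onorm (\<lambda>h. jacobian (\<lambda>u. gradient (g u) w) (at u) *v h) \<le> K"
      by (rule onorm_le, rule norm_mul_vec_le_transpose) (rule K[of u w, unfolded mixed_derivative_def])
  qed auto
  ultimately show "norm (gradient (\<lambda>w. g x w - g y w) w) \<le> K * norm (x - y)" by simp
qed

section \<open>Moments and variance\<close>

lemma P2_integrable_norm:
  assumes "\<nu> \<in> P2"
  shows "integrable \<nu> (\<lambda>x. norm (x - a))" "integrable \<nu> (\<lambda>x. (norm (x - a))\<^sup>2)"
proof -
  interpret prob_space \<nu> using P2D[OF assms] by simp
  note [measurable_cong] = P2D(2)[OF assms]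
  show 1: "integrable \<nu> (\<lambda>x. (norm (x - a))\<^sup>2)"
  proof (rule Bochner_Integration.integrable_bound)
    show "integrable \<nu> (\<lambda>x. 2 * (norm x)\<^sup>2 + 2 * (norm a)\<^sup>2)"
      using P2D[OF assms] by auto
    have "(norm (x - a))\<^sup>2 \<le> 2 * (norm x)\<^sup>2 + 2 * (norm a)\<^sup>2" for x
    proof -
      have "(norm (x - a))\<^sup>2 \<le> (norm x + norm a)\<^sup>2"
        by (intro power_mono norm_triangle_ineq4) simp
      also have "\<dots> \<le> 2 * (norm x)\<^sup>2 + 2 * (norm a)\<^sup>2"
        using sum_squares_bound[of "norm x" "norm a"] by (simp add: power2_sum)
      finally show ?thesis .
    qed
    then show "AE x in \<nu>. norm ((norm (x - a))\<^sup>2) \<le> norm (2 * (norm x)\<^sup>2 + 2 * (norm a)\<^sup>2)"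
      by (intro AE_I2) simp
  qed measurable
  show "integrable \<nu> (\<lambda>x. norm (x - a))"
  proof (rule Bochner_Integration.integrable_bound)
    show "integrable \<nu> (\<lambda>x. 1 + (norm (x - a))\<^sup>2)" using 1 by auto
    have "\<bar>s\<bar> \<le> 1 + s\<^sup>2" for s :: real
      using zero_le_power2[of "\<bar>s\<bar> - 1"] abs_ge_zero[of s]
      unfolding power2_diff power2_abs power_one mult_1_right by linarith
    then show "AE x in \<nu>. norm (norm (x - a)) \<le> norm (1 + (norm (x - a))\<^sup>2)"
      by (intro AE_I2) (metis abs_of_nonneg abs_norm_cancel real_norm_def add_nonneg_nonneg
        zero_le_one zero_le_power2)
  qed measurable
qed

lemma lipschitz_borel_measurable:
  fixes f :: "real ^ 'd \<Rightarrow> real"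
  assumes "\<And>x y. \<bar>f x - f y\<bar> \<le> K * norm (x - y)"
  shows "f \<in> borel_measurable borel"
proof (rule borel_measurable_continuous_onI)
  have "\<bar>K\<bar>-lipschitz_on UNIV f"
    using order_trans[OF assms mult_right_mono[OF abs_ge_self norm_ge_zero]]
    by (intro lipschitz_onI) (auto simp: dist_norm)
  then show "continuous_on UNIV f" by (rule lipschitz_on_continuous_on)
qed

lemma P2_integrable_lipschitz:
  fixes f :: "real ^ 'd \<Rightarrow> real"
  assumes "\<nu> \<in> P2" "\<And>x y. \<bar>f x - f y\<bar> \<le> K * norm (x - y)"
  shows "integrable \<nu> f"
proof -
  interpret prob_space \<nu> using P2D[OF assms(1)] by simp
  note [measurable_cong] = P2D(2)[OF assms(1)]
  note [measurable] = lipschitz_borel_measurable[OF assms(2)]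
  show ?thesis
  proof (rule Bochner_Integration.integrable_bound)
    show "integrable \<nu> (\<lambda>x. \<bar>f 0\<bar> + \<bar>K\<bar> * norm (x - 0))"
      using P2_integrable_norm[OF assms(1), of 0] by auto
    have "\<bar>f x\<bar> \<le> \<bar>f 0\<bar> + \<bar>K\<bar> * norm (x - 0)" for x
      using assms(2)[of x 0] mult_right_mono[OF abs_ge_self[of K], of "norm x"] by simp
    then show "AE x in \<nu>. norm (f x) \<le> norm (\<bar>f 0\<bar> + \<bar>K\<bar> * norm (x - 0))"
      by (intro AE_I2) simp
  qed measurable
qed

text \<open>The trace of the covariance matrix.\<close>

definition total_variance :: "(real ^ 'd) measure \<Rightarrow> real" where
  "total_variance \<nu> = (\<integral>x. (norm (x - (\<integral>y. y \<partial>\<nu>)))\<^sup>2 \<partial>\<nu>)"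

lemma total_variance_nonneg: "total_variance \<nu> \<ge> 0"
  by (simp add: total_variance_def)

text \<open>The cross term vanishes since x minus the mean integrates to zero. It yields the factor
  2 when a is itself drawn from \<open>\<nu>\<close>, and it bounds the variance by the second
  moment about any point.\<close>

lemma integral_norm_diff_sq:
  assumes "\<nu> \<in> P2"
  shows "(\<integral>x. (norm (x - a))\<^sup>2 \<partial>\<nu>) = total_variance \<nu> + (norm (a - (\<integral>y. y \<partial>\<nu>)))\<^sup>2"
proof -
  interpret prob_space \<nu> using P2D[OF assms] by simp
  note [measurable_cong] = P2D(2)[OF assms]
  define m where "m = (\<integral>y. y \<partial>\<nu>)"
  have id: "integrable \<nu> (\<lambda>x. x)"
    using P2_integrable_norm(1)[OF assms, of 0] by (subst (asm) integrable_norm_iff) auto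
  have "(\<integral>x. (norm (x - a))\<^sup>2 \<partial>\<nu>)
      = (\<integral>x. (norm (x - m))\<^sup>2 + (norm (a - m))\<^sup>2 - 2 * ((x - m) \<bullet> (a - m)) \<partial>\<nu>)"
    by (intro Bochner_Integration.integral_cong refl)
       (simp add: power2_norm_eq_inner algebra_simps inner_commute)
  also have "\<dots> = (\<integral>x. (norm (x - m))\<^sup>2 \<partial>\<nu>) + (norm (a - m))\<^sup>2 - 2 * ((\<integral>x. x - m \<partial>\<nu>) \<bullet> (a - m))"
    using P2_integrable_norm[OF assms] id by (simp add: prob_space)
  also have "(\<integral>x. x - m \<partial>\<nu>) = 0"
    using id by (simp add: m_def prob_space)
  finally show ?thesis by (simp add: total_variance_def m_def)
qed

text \<open>The variance of the distance |x - a| is nonnegative.\<close>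

lemma integral_norm_sq_le:
  assumes "\<nu> \<in> P2"
  shows "(\<integral>x. norm (x - a) \<partial>\<nu>)\<^sup>2 \<le> (\<integral>x. (norm (x - a))\<^sup>2 \<partial>\<nu>)"
proof -
  interpret prob_space \<nu> using P2D[OF assms] by simp
  define m where "m = (\<integral>x. norm (x - a) \<partial>\<nu>)"
  have "0 \<le> (\<integral>x. (norm (x - a) - m)\<^sup>2 \<partial>\<nu>)" by simp
  also have "\<dots> = (\<integral>x. (norm (x - a))\<^sup>2 - 2 * m * norm (x - a) + m\<^sup>2 \<partial>\<nu>)"
    by (simp add: power2_diff mult_ac algebra_simps)
  also have "\<dots> = (\<integral>x. (norm (x - a))\<^sup>2 \<partial>\<nu>) - 2 * m * m + m\<^sup>2"
    using P2_integrable_norm[OF assms] by (simp add: m_def prob_space)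
  finally show ?thesis by (simp add: m_def power2_eq_square)
qed

section \<open>Replacing one particle\<close>

locale mean_field_energy =
  fixes F :: "(real ^ 'd) measure \<Rightarrow> real"
    and dF :: "(real ^ 'd) measure \<Rightarrow> real ^ 'd \<Rightarrow> real"
    and d2F :: "(real ^ 'd) measure \<Rightarrow> real ^ 'd \<Rightarrow> real ^ 'd \<Rightarrow> real"
    and \<beta> B :: real
  assumes first_var: "first_variation F dF"
    and second_var: "second_variation dF d2F"
    and diff1: "\<And>\<nu> x. \<nu> \<in> P2 \<Longrightarrow> dF \<nu> differentiable (at x)"
    and diff2: "\<And>\<nu>. \<nu> \<in> P2 \<Longrightarrow> mixed_differentiable (d2F \<nu>)"
    and conv: "\<And>\<nu> \<nu>' t. \<nu> \<in> P2 \<Longrightarrow> \<nu>' \<in> P2 \<Longrightarrow> t \<in> {0..1} \<Longrightarrow>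
               F (lin_interp t \<nu> \<nu>') \<le> (1 - t) * F \<nu> + t * F \<nu>'"
    and onorm_le: "\<And>\<nu> x y. \<nu> \<in> P2 \<Longrightarrow> onorm ((*v) (mixed_derivative (d2F \<nu>) x y)) \<le> \<beta>"
    and grad_le: "\<And>\<nu> x. \<nu> \<in> P2 \<Longrightarrow> norm (gradient (dF \<nu>) x) \<le> B"
begin

lemma \<beta>_nonneg: "\<beta> \<ge> 0"
  using onorm_pos_le[OF matrix_vector_mul_bounded_linear] onorm_le[OF return_in_P2] by (rule order_trans)

lemma dF_lipschitz: "\<nu> \<in> P2 \<Longrightarrow> \<bar>dF \<nu> x - dF \<nu> y\<bar> \<le> B * norm (x - y)"
  using diff1 grad_le by (rule lipschitz_gradient_bound)

text \<open>\<open>shift\<close> says, without signed measures, that \<open>\<nu>'\<close> minus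
  \<open>\<nu>\<close> is \<epsilon> times the Dirac mass at x minus \<eta>: it gives the action on
  functions integrable under every measure of \<open>P2\<close>. The bound results from testing this
  difference on a function with Lipschitz constant \<beta> |x - y|.\<close>

lemma dF_difference_bound:
  assumes \<nu>: "\<nu> \<in> P2" "\<nu>' \<in> P2" "\<eta> \<in> P2" and "\<epsilon> \<ge> 0"
    and shift: "\<And>f. (\<And>\<rho>. \<rho> \<in> P2 \<Longrightarrow> integrable \<rho> f) \<Longrightarrow>
      (\<integral>z. f z \<partial>\<nu>') - (\<integral>z. f z \<partial>\<nu>) = \<epsilon> * (f x - (\<integral>z. f z \<partial>\<eta>))"
  shows "(dF \<nu>' x - dF \<nu> x) - (dF \<nu>' y - dF \<nu> y)
    \<le> \<epsilon> * \<beta> * norm (y - x) * (\<integral>z. norm (z - x) \<partial>\<eta>)"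
proof -
  interpret \<eta>: prob_space \<eta> using P2D[OF \<nu>(3)] by simp
  \<comment> \<open>The difference at x and y is treated as one functional: separate mean value
    arguments would produce two intermediate measures, and no mixed difference of a single
    \<open>d2F \<rho>\<close> would appear.\<close>
  have "first_variation (\<lambda>\<rho>. dF \<rho> x - dF \<rho> y) (\<lambda>\<rho> z. d2F \<rho> x z - d2F \<rho> y z)"
    unfolding first_variation_def
  proof (intro ballI)
    fix \<rho> \<rho>' :: "(real ^ 'd) measure" assume \<rho>: "\<rho> \<in> P2" "\<rho>' \<in> P2"
    have v: "first_variation (\<lambda>\<nu>. dF \<nu> w) (\<lambda>\<nu>. d2F \<nu> w)" for w
      using second_var by (simp add: second_variation_def)
    note fv = first_variationD[OF v \<rho>] first_variationD[OF v \<rho>(1,1)]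
    have "((\<lambda>t. dF (lin_interp t \<rho> \<rho>') x - dF (lin_interp t \<rho> \<rho>') y) has_real_derivative
        ((\<integral>z. d2F \<rho> x z \<partial>\<rho>') - (\<integral>z. d2F \<rho> x z \<partial>\<rho>)) - ((\<integral>z. d2F \<rho> y z \<partial>\<rho>') - (\<integral>z. d2F \<rho> y z \<partial>\<rho>)))
        (at_right 0)"
      by (intro derivative_intros fv)
    then show "integrable \<rho>' (\<lambda>z. d2F \<rho> x z - d2F \<rho> y z) \<and>
        ((\<lambda>t. dF (lin_interp t \<rho> \<rho>') x - dF (lin_interp t \<rho> \<rho>') y) has_real_derivative
           (\<integral>z. d2F \<rho> x z - d2F \<rho> y z \<partial>\<rho>') - (\<integral>z. d2F \<rho> x z - d2F \<rho> y z \<partial>\<rho>)) (at_right 0)"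
      using fv by (simp add: algebra_simps)
  qed
  from mvt_lin_interp[OF this \<nu>(1,2)] obtain \<rho> where \<rho>: "\<rho> \<in> P2"
    and eq: "(dF \<nu>' x - dF \<nu>' y) - (dF \<nu> x - dF \<nu> y)
      = (\<integral>z. d2F \<rho> x z - d2F \<rho> y z \<partial>\<nu>') - (\<integral>z. d2F \<rho> x z - d2F \<rho> y z \<partial>\<nu>)"
    by blast
  define h where "h z = d2F \<rho> x z - d2F \<rho> y z" for z
  have h: "\<bar>h z - h z'\<bar> \<le> \<beta> * norm (x - y) * norm (z - z')" for z z'
    unfolding h_def by (rule mixed_difference_bound[OF diff2[OF \<rho>] onorm_le[OF \<rho>]])
  have h_int: "\<rho>' \<in> P2 \<Longrightarrow> integrable \<rho>' h" for \<rho>'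
    by (rule P2_integrable_lipschitz[OF _ h])
  have "(dF \<nu>' x - dF \<nu>' y) - (dF \<nu> x - dF \<nu> y) = \<epsilon> * (h x - (\<integral>z. h z \<partial>\<eta>))"
    unfolding eq h_def[symmetric] by (rule shift) (rule h_int)
  also have "h x - (\<integral>z. h z \<partial>\<eta>) = (\<integral>z. h x - h z \<partial>\<eta>)"
    using h_int[OF \<nu>(3)] by (simp add: \<eta>.prob_space)
  also have "\<dots> \<le> (\<integral>z. \<beta> * norm (x - y) * norm (z - x) \<partial>\<eta>)"
  proof (rule integral_mono)
    show "h x - h z \<le> \<beta> * norm (x - y) * norm (z - x)" for z
      using h[of x z] by (simp add: norm_minus_commute)
  qed (use h_int P2_integrable_norm \<nu>(3) in auto)
  finally have "(dF \<nu>' x - dF \<nu>' y) - (dF \<nu> x - dF \<nu> y)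
      \<le> \<epsilon> * (\<beta> * norm (x - y) * (\<integral>z. norm (z - x) \<partial>\<eta>))"
    using \<open>\<epsilon> \<ge> 0\<close> by (simp add: mult_left_mono)
  then show ?thesis by (simp add: norm_minus_commute mult.assoc)
qed

text \<open>The tangent inequality at the new measure \<open>\<nu>'\<close> bounds the increment by
  \<epsilon> times a centred value of \<open>dF \<nu>'\<close>; exchanging \<open>dF \<nu>'\<close>
  for \<open>dF \<nu>\<close> costs another factor \<epsilon>. Convexity thus replaces a
  second-order expansion, at the price of the factor 1/2 in its remainder.\<close>

lemma energy_replace_le:
  assumes \<nu>: "\<nu> \<in> P2" "\<nu>' \<in> P2" "\<eta> \<in> P2" and "\<epsilon> \<ge> 0"
    and shift: "\<And>f. (\<And>\<rho>. \<rho> \<in> P2 \<Longrightarrow> integrable \<rho> f) \<Longrightarrow>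
      (\<integral>z. f z \<partial>\<nu>') - (\<integral>z. f z \<partial>\<nu>) = \<epsilon> * (f x - (\<integral>z. f z \<partial>\<eta>))"
  shows "F \<nu>' - F \<nu> \<le> \<epsilon> * (dF \<nu> x - (\<integral>z. dF \<nu> z \<partial>\<eta>))
    + \<epsilon>\<^sup>2 * \<beta> * (\<integral>z. (norm (z - x))\<^sup>2 \<partial>\<eta>)"
proof -
  interpret \<eta>: prob_space \<eta> using P2D[OF \<nu>(3)] by simp
  define m where "m = (\<integral>z. norm (z - x) \<partial>\<eta>)"
  have int: "\<rho> \<in> P2 \<Longrightarrow> \<rho>' \<in> P2 \<Longrightarrow> integrable \<rho>' (dF \<rho>)" for \<rho> \<rho>'
    using first_variationD(1)[OF first_var] by blast
  have "F \<nu>' - F \<nu> \<le> (\<integral>z. dF \<nu>' z \<partial>\<nu>') - (\<integral>z. dF \<nu>' z \<partial>\<nu>)"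
    using convex_first_variation_le[OF first_var \<nu>(2,1) conv[OF \<nu>(2,1)]] by simp
  also have "\<dots> = \<epsilon> * (dF \<nu>' x - (\<integral>z. dF \<nu>' z \<partial>\<eta>))"
    using int \<nu> by (intro shift) auto
  also have "dF \<nu>' x - (\<integral>z. dF \<nu>' z \<partial>\<eta>) = (dF \<nu> x - (\<integral>z. dF \<nu> z \<partial>\<eta>))
      + (\<integral>z. (dF \<nu>' x - dF \<nu> x) - (dF \<nu>' z - dF \<nu> z) \<partial>\<eta>)"
    using int \<nu> by (simp add: \<eta>.prob_space)
  \<comment> \<open>The distance |z - x| enters twice, once between the evaluation points and once
    averaged inside the bound, so integration over \<eta> gives m^2.\<close>
  also have "(\<integral>z. (dF \<nu>' x - dF \<nu> x) - (dF \<nu>' z - dF \<nu> z) \<partial>\<eta>)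
      \<le> (\<integral>z. \<epsilon> * \<beta> * norm (z - x) * m \<partial>\<eta>)"
    unfolding m_def
    by (intro integral_mono dF_difference_bound assms)
       (use int P2_integrable_norm \<nu> in auto)
  also have "\<dots> = \<epsilon> * \<beta> * m\<^sup>2"
    by (simp add: m_def power2_eq_square mult_ac)
  also have "\<dots> \<le> \<epsilon> * \<beta> * (\<integral>z. (norm (z - x))\<^sup>2 \<partial>\<eta>)"
    unfolding m_def using \<open>\<epsilon> \<ge> 0\<close> \<beta>_nonneg
    by (intro mult_left_mono integral_norm_sq_le \<nu>) auto
  finally have "F \<nu>' - F \<nu> \<le> \<epsilon> * ((dF \<nu> x - (\<integral>z. dF \<nu> z \<partial>\<eta>))
      + \<epsilon> * \<beta> * (\<integral>z. (norm (z - x))\<^sup>2 \<partial>\<eta>))"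
    using \<open>\<epsilon> \<ge> 0\<close> by (simp add: mult_left_mono)
  then show ?thesis by (simp add: power2_eq_square distrib_left mult.assoc)
qed

end

section \<open>Expected energy of the empirical measure\<close>

text \<open>The Lipschitz bound makes H continuous in the product topology, and countability of the
  index type identifies the Borel sets of the full function space with its product \<sigma>-algebra.
  The map P, which fills the coordinates outside I with 0 and leaves H unchanged, pulls this back to
  the product over I.\<close>

lemma lipschitz_PiM_measurable:
  fixes H :: "('i::countable \<Rightarrow> 'a::{second_countable_topology, real_normed_vector}) \<Rightarrow> real" and I :: "'i set"
  assumes "finite I" and H: "\<And>x y. \<bar>H x - H y\<bar> \<le> K * (\<Sum>i\<in>I. norm (x i - y i))"
  shows "H \<in> borel_measurable (PiM I (\<lambda>_. borel))"
proof -
  define P where "P x i = (if i \<in> I then x i else 0)" for x :: "'i \<Rightarrow> 'a" and i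
  have "continuous_on UNIV H"
  proof (unfold continuous_on_def, intro ballI)
    fix x :: "'i \<Rightarrow> 'a"
    have "((\<lambda>y. K * (\<Sum>i\<in>I. norm (y i - x i))) \<longlongrightarrow> K * (\<Sum>i\<in>I. norm (x i - x i))) (at x)"
      by (intro tendsto_intros continuous_on_tendsto_compose[OF continuous_on_product_coordinates tendsto_ident_at]) auto
    then show "(H \<longlongrightarrow> H x) (at x within UNIV)"
      using H by (intro LIM_zero_cancel[of H]) (rule Lim_null_comparison, auto)
  qed
  then have [measurable]: "H \<in> borel_measurable borel"
    by (rule borel_measurable_continuous_onI)
  have "P \<in> PiM I (\<lambda>_. borel) \<rightarrow>\<^sub>M PiM UNIV (\<lambda>_. borel)"
  proof (rule measurable_PiM_single')
    show "(\<lambda>x. P x i) \<in> PiM I (\<lambda>_. borel) \<rightarrow>\<^sub>M borel" for i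
      by (cases "i \<in> I") (auto simp: P_def)
  qed auto
  then have [measurable]: "P \<in> PiM I (\<lambda>_. borel) \<rightarrow>\<^sub>M borel"
    by (simp add: measurable_cong_sets[OF refl sets_PiM_equal_borel] cong: measurable_cong_sets)
  have "H (P x) = H x" for x
    using H[of "P x" x] by (simp add: P_def)
  then have "H = (\<lambda>x. H (P x))" by simp
  also have "\<dots> \<in> borel_measurable (PiM I (\<lambda>_. borel))" by measurable
  finally show ?thesis .
qed

lemma empirical_in_P2: "N \<ge> 1 \<Longrightarrow> empirical N x \<in> P2"
  unfolding empirical_def by (intro avg_measure_in_P2 return_in_P2)

lemma avg_measure_cong:
  assumes "\<And>i. i \<in> {1..N} \<Longrightarrow> \<nu> i = \<nu>' i"
  shows "avg_measure N \<nu> = avg_measure N \<nu>'"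
proof -
  have "(\<Sum>i\<in>{1..N}. emeasure (\<nu> i) A) = (\<Sum>i\<in>{1..N}. emeasure (\<nu>' i) A)" for A
    using assms by (intro sum.cong) auto
  then show ?thesis unfolding avg_measure_def by presburger
qed

text \<open>Membership in \<open>P2\<close> is asked at every index, also outside {1..N}, because
  \<open>product_prob_space\<close> wants a probability measure at each.\<close>

locale mean_field_product = mean_field_energy F dF d2F \<beta> B
  for F :: "(real ^ 'd) measure \<Rightarrow> real" and dF d2F \<beta> B +
  fixes N :: nat and \<pi> :: "nat \<Rightarrow> (real ^ 'd) measure"
  assumes N: "N \<ge> 1" and \<pi>: "\<And>i. \<pi> i \<in> P2"
begin

lemma prob_\<pi>: "prob_space (\<pi> i)"
  using \<pi> by (rule P2D)

sublocale product_prob_space \<pi> "{1..N}"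
  by (intro product_prob_space.intro product_sigma_finite.intro product_prob_space_axioms.intro
      prob_space_imp_sigma_finite prob_\<pi>)

lemma sets_\<pi>[measurable_cong]: "sets (\<pi> i) = sets borel"
  using \<pi> by (rule P2D)

lemma sets_PiM_\<pi>[measurable_cong]: "sets (PiM I \<pi>) = sets (PiM I (\<lambda>_. borel))"
  by (rule sets_PiM_cong) (simp_all add: sets_\<pi>)

lemma space_\<pi>[simp]: "space (\<pi> i) = UNIV"
  using \<pi> by (rule P2D)

text \<open>The hybrids of the replacement argument, running from the average of the laws at J empty
  to the empirical measure at J = {1..N}.\<close>

definition partial_empirical :: "nat set \<Rightarrow> (nat \<Rightarrow> real ^ 'd) \<Rightarrow> (real ^ 'd) measure" where
  "partial_empirical J x = avg_measure N (\<lambda>i. if i \<in> J then return borel (x i) else \<pi> i)"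

lemma partial_empirical_in_P2: "partial_empirical J x \<in> P2"
  unfolding partial_empirical_def by (intro avg_measure_in_P2 N) (auto intro: return_in_P2 \<pi>)

lemma partial_empirical_empty: "partial_empirical {} x = avg_measure N \<pi>"
  by (simp add: partial_empirical_def)

lemma partial_empirical_all: "partial_empirical {1..N} x = empirical N x"
  unfolding partial_empirical_def empirical_def by (intro avg_measure_cong) simp

lemma integral_partial_empirical:
  assumes f: "\<And>\<rho>. \<rho> \<in> P2 \<Longrightarrow> integrable \<rho> f"
  shows "(\<integral>z. f z \<partial>partial_empirical J x)
    = (\<Sum>i\<in>{1..N}. if i \<in> J then f (x i) else (\<integral>z. f z \<partial>\<pi> i)) / real N"
proof -
  \<comment> \<open>Integrability under a Dirac mass on the Borel sets already contains Borel
    measurability.\<close>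
  have [measurable]: "f \<in> borel_measurable borel"
    using borel_measurable_integrable[OF f[OF return_in_P2]] by (simp cong: measurable_cong_sets)
  have "(\<integral>z. f z \<partial>partial_empirical J x)
      = (\<Sum>i\<in>{1..N}. \<integral>z. f z \<partial>(if i \<in> J then return borel (x i) else \<pi> i)) / real N"
    unfolding partial_empirical_def
    by (intro integral_avg_measure) (auto intro: return_in_P2 \<pi> f)
  also have "(\<Sum>i\<in>{1..N}. \<integral>z. f z \<partial>(if i \<in> J then return borel (x i) else \<pi> i))
      = (\<Sum>i\<in>{1..N}. if i \<in> J then f (x i) else (\<integral>z. f z \<partial>\<pi> i))"
    by (intro sum.cong) (auto simp: integral_return)
  finally show ?thesis .
qed

lemma dF_integrable: "\<nu> \<in> P2 \<Longrightarrow> \<rho> \<in> P2 \<Longrightarrow> integrable \<rho> (dF \<nu>)"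
  using first_variationD(1)[OF first_var] .

text \<open>On the segment between two hybrids the contributions of the \<open>\<pi> i\<close>
  cancel, and moving one sample changes the integral of \<open>dF \<rho>\<close> by at most B/N
  times its displacement. Measurability and integrability of the energy as a function of the samples
  follow from this.\<close>

lemma energy_lipschitz:
  "\<bar>F (partial_empirical J x) - F (partial_empirical J y)\<bar> \<le> B / N * (\<Sum>i\<in>{1..N}. norm (x i - y i))"
proof -
  obtain \<rho> where \<rho>: "\<rho> \<in> P2" and eq: "F (partial_empirical J x) - F (partial_empirical J y)
      = (\<integral>z. dF \<rho> z \<partial>partial_empirical J x) - (\<integral>z. dF \<rho> z \<partial>partial_empirical J y)"
    using mvt_lin_interp[OF first_var partial_empirical_in_P2 partial_empirical_in_P2] by blast
  have B: "0 \<le> B" using norm_ge_zero grad_le[OF \<rho>] by (rule order_trans)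
  have e: "(\<integral>z. dF \<rho> z \<partial>partial_empirical J x)
    = (\<Sum>i\<in>{1..N}. if i \<in> J then dF \<rho> (x i) else (\<integral>z. dF \<rho> z \<partial>\<pi> i)) / real N" for x
    by (intro integral_partial_empirical dF_integrable \<rho>)
  have "F (partial_empirical J x) - F (partial_empirical J y)
      = (\<Sum>i\<in>{1..N}. if i \<in> J then dF \<rho> (x i) - dF \<rho> (y i) else 0) / real N"
    unfolding eq e diff_divide_distrib[symmetric] sum_subtractf[symmetric]
    by (intro sum.cong arg_cong2[where f = "(/)"]) auto
  also have "\<bar>\<dots>\<bar> \<le> (\<Sum>i\<in>{1..N}. B * norm (x i - y i)) / real N"
    unfolding abs_divide abs_of_nat using dF_lipschitz[OF \<rho>] B
    by (intro divide_right_mono order_trans[OF sum_abs] sum_mono) auto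
  finally show ?thesis by (simp add: sum_distrib_left sum_divide_distrib)
qed

lemma energy_measurable [measurable]:
  "(\<lambda>x. F (partial_empirical J x)) \<in> borel_measurable (PiM {1..N} (\<lambda>_. borel))"
  by (rule lipschitz_PiM_measurable[OF _ energy_lipschitz]) simp

lemma integrable_PiM_component:
  fixes f :: "real ^ 'd \<Rightarrow> real"
  assumes i: "i \<in> {1..N}" and f: "integrable (\<pi> i) f"
  shows "integrable (PiM {1..N} \<pi>) (\<lambda>x. f (x i))"
    "(\<integral>x. f (x i) \<partial>PiM {1..N} \<pi>) = (\<integral>z. f z \<partial>\<pi> i)"
proof -
  have d: "distr (PiM {1..N} \<pi>) (\<pi> i) (\<lambda>x. x i) = \<pi> i" by (rule PiM_component[OF i])
  have m: "(\<lambda>x. x i) \<in> PiM {1..N} \<pi> \<rightarrow>\<^sub>M \<pi> i" "f \<in> borel_measurable (\<pi> i)"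
    using measurable_component_singleton[OF i] f by auto
  show "integrable (PiM {1..N} \<pi>) (\<lambda>x. f (x i))"
    using integrable_distr_eq[OF m] f unfolding d by blast
  show "(\<integral>x. f (x i) \<partial>PiM {1..N} \<pi>) = (\<integral>z. f z \<partial>\<pi> i)"
    using integral_distr[OF m] unfolding d by simp
qed

lemma energy_integrable: "integrable (PiM {1..N} \<pi>) (\<lambda>x. F (partial_empirical J x))"
proof (rule Bochner_Integration.integrable_bound)
  let ?b = "\<lambda>x. \<bar>F (partial_empirical J (\<lambda>_. 0))\<bar> + B / N * (\<Sum>i\<in>{1..N}. norm (x i - 0))"
  show "integrable (PiM {1..N} \<pi>) ?b"
    by (intro Bochner_Integration.integrable_add integrable_mult_right Bochner_Integration.integrable_sum
        P.integrable_const integrable_PiM_component[of _ "\<lambda>x. norm (x - 0)"] P2_integrable_norm \<pi>) auto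
  have "\<bar>F (partial_empirical J x)\<bar> \<le> ?b x" for x
    using energy_lipschitz[of J x "\<lambda>_. 0"] by linarith
  then show "AE x in PiM {1..N} \<pi>. norm (F (partial_empirical J x)) \<le> norm (?b x)"
    unfolding real_norm_def by (intro AE_I2 order_trans[OF _ abs_ge_self])
qed measurable

text \<open>Inserting j moves mass 1/N from \<open>\<pi> j\<close> to the Dirac mass at
  \<open>x j\<close>, so \<open>energy_replace_le\<close> applies with \<epsilon> = 1/N.\<close>

lemma energy_step_pointwise:
  assumes j: "j \<in> {1..N}" "j \<notin> J"
  shows "F (partial_empirical (insert j J) x) - F (partial_empirical J x)
    \<le> (dF (partial_empirical J x) (x j) - (\<integral>z. dF (partial_empirical J x) z \<partial>\<pi> j)) / N
      + \<beta> / (real N)\<^sup>2 * (\<integral>z. (norm (z - x j))\<^sup>2 \<partial>\<pi> j)"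
proof -
  have "F (partial_empirical (insert j J) x) - F (partial_empirical J x)
    \<le> 1 / N * (dF (partial_empirical J x) (x j) - (\<integral>z. dF (partial_empirical J x) z \<partial>\<pi> j))
      + (1 / N)\<^sup>2 * \<beta> * (\<integral>z. (norm (z - x j))\<^sup>2 \<partial>\<pi> j)"
  proof (rule energy_replace_le)
    fix f :: "real ^ 'd \<Rightarrow> real" assume f: "\<And>\<rho>. \<rho> \<in> P2 \<Longrightarrow> integrable \<rho> f"
    have e: "(\<integral>z. f z \<partial>partial_empirical K x)
      = (\<Sum>i\<in>{1..N}. if i \<in> K then f (x i) else (\<integral>z. f z \<partial>\<pi> i)) / real N" for K
      by (intro integral_partial_empirical f)
    have "(\<integral>z. f z \<partial>partial_empirical (insert j J) x) - (\<integral>z. f z \<partial>partial_empirical J x)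
      = (\<Sum>i\<in>{1..N}. if i = j then f (x j) - (\<integral>z. f z \<partial>\<pi> j) else 0) / N"
      unfolding e diff_divide_distrib[symmetric] sum_subtractf[symmetric]
      using j(2) by (intro sum.cong arg_cong2[where f = "(/)"]) auto
    then show "(\<integral>z. f z \<partial>partial_empirical (insert j J) x) - (\<integral>z. f z \<partial>partial_empirical J x)
      = 1 / N * (f (x j) - (\<integral>z. f z \<partial>\<pi> j))"
      using j(1) by simp
  qed (auto intro: partial_empirical_in_P2 \<pi>)
  then show ?thesis by (simp add: power_divide)
qed

lemma partial_empirical_update: "j \<notin> J \<Longrightarrow> partial_empirical J (x(j := y)) = partial_empirical J x"
  unfolding partial_empirical_def by (intro avg_measure_cong) auto

text \<open>With the other coordinates frozen, \<open>\<nu>\<close> does not depend on coordinate j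
  since j lies outside J, so the first-order term is centred under \<open>\<pi> j\<close>. The
  remainder averages the squared distance of two independent copies, which is twice the
  variance.\<close>

lemma energy_step_coordinate:
  assumes j: "j \<in> {1..N}" "j \<notin> J"
  shows "(\<integral>y. F (partial_empirical (insert j J) (x(j := y))) - F (partial_empirical J (x(j := y))) \<partial>\<pi> j)
    \<le> 2 * \<beta> / (real N)\<^sup>2 * total_variance (\<pi> j)"
proof -
  define \<nu> where "\<nu> = partial_empirical J x"
  have \<nu>: "\<nu> \<in> P2" unfolding \<nu>_def by (rule partial_empirical_in_P2)
  define m v where "m = (\<integral>y. y \<partial>\<pi> j)" and "v = total_variance (\<pi> j)"
  have v: "(\<integral>y. (norm (y - m))\<^sup>2 \<partial>\<pi> j) = v"
    by (simp add: v_def m_def total_variance_def)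
  have "(\<integral>y. F (partial_empirical (insert j J) (x(j := y))) - F (partial_empirical J (x(j := y))) \<partial>\<pi> j)
    \<le> (\<integral>y. (dF \<nu> y - (\<integral>z. dF \<nu> z \<partial>\<pi> j)) / N + \<beta> / (real N)\<^sup>2 * (v + (norm (y - m))\<^sup>2) \<partial>\<pi> j)"
  proof (rule integral_mono)
    have "integrable (\<pi> j) (\<lambda>y. F (partial_empirical (insert j J) (x(j := y))))"
    proof (rule P2_integrable_lipschitz[OF \<pi>])
      fix y z
      have "(\<Sum>i\<in>{1..N}. norm ((x(j := y)) i - (x(j := z)) i)) = (\<Sum>i\<in>{1..N}. if i = j then norm (y - z) else 0)"
        by (intro sum.cong) auto
      also have "\<dots> = norm (y - z)" using j(1) by simp
      finally show "\<bar>F (partial_empirical (insert j J) (x(j := y))) - F (partial_empirical (insert j J) (x(j := z)))\<bar>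
          \<le> B / N * norm (y - z)"
        using energy_lipschitz[of "insert j J" "x(j := y)" "x(j := z)"] by simp
    qed
    then show "integrable (\<pi> j) (\<lambda>y. F (partial_empirical (insert j J) (x(j := y)))
        - F (partial_empirical J (x(j := y))))"
      by (simp add: partial_empirical_update[OF j(2)])
    show "integrable (\<pi> j) (\<lambda>y. (dF \<nu> y - (\<integral>z. dF \<nu> z \<partial>\<pi> j)) / N + \<beta> / (real N)\<^sup>2 * (v + (norm (y - m))\<^sup>2))"
      using dF_integrable[OF \<nu> \<pi>] P2_integrable_norm[OF \<pi>] by auto
    fix y
    show "F (partial_empirical (insert j J) (x(j := y))) - F (partial_empirical J (x(j := y)))
        \<le> (dF \<nu> y - (\<integral>z. dF \<nu> z \<partial>\<pi> j)) / N + \<beta> / (real N)\<^sup>2 * (v + (norm (y - m))\<^sup>2)"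
      using energy_step_pointwise[OF j, of "x(j := y)"]
      by (simp add: partial_empirical_update[OF j(2)] \<nu>_def v_def m_def integral_norm_diff_sq[OF \<pi>])
  qed
  also have "\<dots> = \<beta> / (real N)\<^sup>2 * (v + v)"
    using dF_integrable[OF \<nu> \<pi>] P2_integrable_norm[OF \<pi>] M.prob_space[of j] by (simp add: v)
  finally show ?thesis by (simp add: v_def mult_ac)
qed

lemma energy_step:
  assumes j: "j \<in> {1..N}" "j \<notin> J"
  shows "(\<integral>x. F (partial_empirical (insert j J) x) \<partial>PiM {1..N} \<pi>)
    \<le> (\<integral>x. F (partial_empirical J x) \<partial>PiM {1..N} \<pi>) + 2 * \<beta> / (real N)\<^sup>2 * total_variance (\<pi> j)"
proof -
  let ?f = "\<lambda>x. F (partial_empirical (insert j J) x) - F (partial_empirical J x)"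
  let ?c = "2 * \<beta> / (real N)\<^sup>2 * total_variance (\<pi> j)"
  interpret R: prob_space "PiM ({1..N} - {j}) \<pi>"
    by (rule prob_space_PiM) (rule prob_\<pi>)
  have I: "insert j ({1..N} - {j}) = {1..N}" using j by auto
  have "(\<integral>x. ?f x \<partial>PiM {1..N} \<pi>) = (\<integral>x. (\<integral>y. ?f (x(j := y)) \<partial>\<pi> j) \<partial>PiM ({1..N} - {j}) \<pi>)"
    using product_integral_insert[of "{1..N} - {j}" j ?f] energy_integrable unfolding I by auto
  also have "\<dots> \<le> ?c"
  \<comment> \<open>If the inner integral is not integrable, its Bochner integral is 0, and the
    nonnegative bound \<open>?c\<close> covers that case too.\<close>
  proof (cases "integrable (PiM ({1..N} - {j}) \<pi>) (\<lambda>x. \<integral>y. ?f (x(j := y)) \<partial>\<pi> j)")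
    case True
    then show ?thesis
      using energy_step_coordinate[OF j] by (intro R.integral_le_const) auto
  next
    case False
    then show ?thesis
      using \<beta>_nonneg by (simp add: not_integrable_integral_eq total_variance_nonneg)
  qed
  finally show ?thesis using energy_integrable by simp
qed

lemma expected_energy_le:
  "(\<integral>x. F (empirical N x) \<partial>PiM {1..N} \<pi>)
    \<le> F (avg_measure N \<pi>) + 2 * \<beta> / (real N)\<^sup>2 * (\<Sum>i\<in>{1..N}. total_variance (\<pi> i))"
proof -
  have "k \<le> N \<Longrightarrow> (\<integral>x. F (partial_empirical {1..k} x) \<partial>PiM {1..N} \<pi>)
    \<le> F (avg_measure N \<pi>) + 2 * \<beta> / (real N)\<^sup>2 * (\<Sum>i\<in>{1..k}. total_variance (\<pi> i))" for k
  proof (induction k)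
    case 0
    show ?case using P.prob_space by (simp add: partial_empirical_empty)
  next
    case (Suc k)
    let ?E = "\<lambda>J. \<integral>x. F (partial_empirical J x) \<partial>PiM {1..N} \<pi>"
    let ?c = "2 * \<beta> / (real N)\<^sup>2"
    have ins: "{1..Suc k} = insert (Suc k) {1..k}" by auto
    have "?E (insert (Suc k) {1..k}) \<le> ?E {1..k} + ?c * total_variance (\<pi> (Suc k))"
      using Suc.prems by (intro energy_step) auto
    moreover have "?E {1..k} \<le> F (avg_measure N \<pi>) + ?c * (\<Sum>i\<in>{1..k}. total_variance (\<pi> i))"
      using Suc.prems by (intro Suc.IH) auto
    moreover have "(\<Sum>i\<in>insert (Suc k) {1..k}. total_variance (\<pi> i))
        = total_variance (\<pi> (Suc k)) + (\<Sum>i\<in>{1..k}. total_variance (\<pi> i))"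
      by (subst sum.insert) auto
    ultimately show ?case unfolding ins by (simp only: distrib_left)
  qed
  from this[OF order_refl] show ?thesis unfolding partial_empirical_all .
qed

end

section \<open>Variance of perturbed log-concave measures\<close>

lemma strongly_convexD:
  assumes "strongly_convex \<alpha> V" "t \<in> {0..1}"
  shows "V ((1 - t) *\<^sub>R x + t *\<^sub>R y) \<le> (1 - t) * V x + t * V y - \<alpha> / 2 * t * (1 - t) * (norm (x - y))\<^sup>2"
  using assms unfolding strongly_convex_def by blast

lemma strongly_convex_continuous:
  fixes V :: "real ^ 'd \<Rightarrow> real"
  assumes V: "strongly_convex \<alpha> V" and "\<alpha> > 0"
  shows "continuous_on UNIV V"
proof (rule convex_on_continuous)
  show "convex_on UNIV V"
  proof (rule convex_onI)
    fix t :: real and x y :: "real ^ 'd" assume t: "0 < t" "t < 1"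
    have "0 \<le> \<alpha> / 2 * t * (1 - t) * (norm (x - y))\<^sup>2" using t \<open>\<alpha> > 0\<close> by auto
    then show "V ((1 - t) *\<^sub>R x + t *\<^sub>R y) \<le> (1 - t) * V x + t * V y"
      using strongly_convexD[OF V, of t x y] t by simp
  qed simp
qed simp

text \<open>Outside the ball of radius R, strong convexity on the segment from 0 to x forces V x >=
  V 0, so the minimum over the compact ball is global.\<close>

lemma strongly_convex_attains_min:
  fixes V :: "real ^ 'd \<Rightarrow> real"
  assumes V: "strongly_convex \<alpha> V" and "\<alpha> > 0"
  shows "\<exists>x\<^sub>0. \<forall>x. V x\<^sub>0 \<le> V x"
proof -
  have cont: "continuous_on S V" for S
    using strongly_convex_continuous[OF assms] continuous_on_subset by blast
  have inf: "\<exists>u\<in>cball 0 r. \<forall>x\<in>cball 0 r. V u \<le> V x" if "r \<ge> 0" for r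
    using that by (intro continuous_attains_inf cont) auto
  obtain u where u: "\<forall>x\<in>cball 0 1. V u \<le> V x"
    using inf[of 1] by auto
  have u0: "V u \<le> V 0" using u by simp
  \<comment> \<open>Solves \<alpha>/2 (R - 1) = V 0 - V u: from there on the quadratic gain
    outweighs the largest drop of V below V 0 on the unit ball.\<close>
  define R where "R = 1 + 2 * (V 0 - V u) / \<alpha>"
  have "R \<ge> 1" using u0 \<open>\<alpha> > 0\<close> by (simp add: R_def)
  obtain x\<^sub>0 where x\<^sub>0: "\<forall>x\<in>cball 0 R. V x\<^sub>0 \<le> V x"
    using inf[of R] \<open>R \<ge> 1\<close> by auto
  have "V x\<^sub>0 \<le> V x" for x
  proof (cases "norm x \<le> R")
    case False
    \<comment> \<open>Puts \<open>t *\<^sub>R x\<close> on the unit sphere, where V u is a lower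
      bound for V.\<close>
    define t where "t = 1 / norm x"
    have t: "t \<in> {0..1}" "t > 0" and nt: "norm x * t = 1"
      using False \<open>R \<ge> 1\<close> by (auto simp: t_def divide_simps)
    have "norm (t *\<^sub>R x) \<le> 1" using t nt by (simp add: mult.commute)
    then have "V u \<le> V ((1 - t) *\<^sub>R 0 + t *\<^sub>R x)" using u by simp
    also have "\<dots> \<le> (1 - t) * V 0 + t * V x - \<alpha> / 2 * t * (1 - t) * (norm x)\<^sup>2"
      using strongly_convexD[OF V t(1), of 0 x] by simp
    also have "\<alpha> / 2 * t * (1 - t) * (norm x)\<^sup>2 = \<alpha> / 2 * ((norm x * t) * (norm x - norm x * t))"
      by (simp add: power2_eq_square field_simps)
    also have "\<dots> = \<alpha> / 2 * (norm x - 1)" by (simp add: nt)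
    finally have "V u - V 0 + \<alpha> / 2 * (norm x - 1) \<le> t * (V x - V 0)" by (simp add: algebra_simps)
    moreover have "\<alpha> / 2 * (R - 1) \<le> \<alpha> / 2 * (norm x - 1)"
      using False \<open>\<alpha> > 0\<close> by (intro mult_left_mono) auto
    moreover have "\<alpha> / 2 * (R - 1) = V 0 - V u" using \<open>\<alpha> > 0\<close> by (simp add: R_def)
    ultimately have "0 \<le> t * (V x - V 0)" by linarith
    then have "V 0 \<le> V x" using t by (simp add: zero_le_mult_iff)
    moreover have "V x\<^sub>0 \<le> V 0" using x\<^sub>0 \<open>R \<ge> 1\<close> by simp
    ultimately show ?thesis by simp
  qed (use x\<^sub>0 in simp)
  then show ?thesis by blast
qed

text \<open>Strong convexity is used at the weights s and 1 - s, the second time together with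
  minimality of \<open>x\<^sub>0\<close>; each use gains K. To first order at s = 1 this is the
  inequality <grad V(x), x - x0> >= \<alpha> |x - x0|^2, in a form that does not ask V to be
  differentiable.\<close>

lemma strongly_convex_contract_le:
  fixes V :: "real ^ 'd \<Rightarrow> real"
  assumes V: "strongly_convex \<alpha> V" and min: "\<And>x. V x\<^sub>0 \<le> V x" and s: "s \<in> {0..<1}"
  shows "V ((1 - s) *\<^sub>R x\<^sub>0 + s *\<^sub>R x) \<le> V x - (1 - s) * (\<alpha> * s * (norm (x - x\<^sub>0))\<^sup>2)"
proof -
  define K where "K = \<alpha> / 2 * s * (1 - s) * (norm (x\<^sub>0 - x))\<^sup>2"
  have "V ((1 - s) *\<^sub>R x\<^sub>0 + s *\<^sub>R x) \<le> (1 - s) * V x\<^sub>0 + s * V x - K"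
    unfolding K_def using s by (intro strongly_convexD[OF V]) auto
  moreover have "V x\<^sub>0 \<le> s * V x\<^sub>0 + (1 - s) * V x - K"
    using min[of "s *\<^sub>R x\<^sub>0 + (1 - s) *\<^sub>R x"] strongly_convexD[OF V, of "1 - s" x\<^sub>0 x] s
    by (simp add: K_def mult_ac)
  moreover have "(1 - s) * (\<alpha> * s * (norm (x - x\<^sub>0))\<^sup>2) = 2 * K"
    by (simp add: K_def norm_minus_commute)
  ultimately show ?thesis unfolding left_diff_distrib by linarith
qed

lemma lborel_scale:
  fixes f :: "'a::euclidean_space \<Rightarrow> real"
  assumes f: "integrable lborel f" and s: "s > 0"
  shows "integrable lborel (\<lambda>x. f (a + s *\<^sub>R x))"
    "(\<integral>x. f x \<partial>lborel) = s ^ DIM('a) * (\<integral>x. f (a + s *\<^sub>R x) \<partial>lborel)"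
proof -
  let ?D = "distr lborel borel (\<lambda>x. a + s *\<^sub>R x) :: 'a measure"
  have [measurable]: "f \<in> borel_measurable borel" using f by simp
  have eq: "lborel = density ?D (\<lambda>_. ennreal (s ^ DIM('a)))"
    using lborel_affine[of s a] s by simp
  have "integrable (density ?D (\<lambda>_. ennreal (s ^ DIM('a)))) f" using f eq by simp
  then have "integrable ?D f"
    using s by (subst (asm) integrable_density) auto
  then show "integrable lborel (\<lambda>x. f (a + s *\<^sub>R x))"
    by (subst (asm) integrable_distr_eq) auto
  have "(\<integral>x. f x \<partial>lborel) = (\<integral>x. f x \<partial>density ?D (\<lambda>_. ennreal (s ^ DIM('a))))" using eq by simp
  also have "\<dots> = s ^ DIM('a) * (\<integral>x. f x \<partial>?D)"
    using s by (subst integral_density) auto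
  also have "(\<integral>x. f x \<partial>?D) = (\<integral>x. f (a + s *\<^sub>R x) \<partial>lborel)"
    by (subst integral_distr) auto
  finally show "(\<integral>x. f x \<partial>lborel) = s ^ DIM('a) * (\<integral>x. f (a + s *\<^sub>R x) \<partial>lborel)" .
qed

lemma integral_density_proportional:
  fixes g :: "'a \<Rightarrow> real"
  assumes \<nu>: "density_proportional \<nu> M f" and f: "\<And>x. f x \<ge> 0" and g: "integrable \<nu> g"
  shows "integrable M (\<lambda>x. f x * g x)" "(\<integral>x. f x * g x \<partial>M) = (\<integral>x. f x \<partial>M) * (\<integral>x. g x \<partial>\<nu>)"
proof -
  let ?Z = "\<integral>x. f x \<partial>M"
  have fM: "integrable M f" and Z: "?Z > 0" and eq: "\<nu> = density M (\<lambda>x. ennreal (f x / ?Z))"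
    using \<nu> by (auto simp: density_proportional_def)
  have [measurable]: "f \<in> borel_measurable M" using fM by simp
  have [measurable]: "g \<in> borel_measurable M"
    using borel_measurable_integrable[OF g] by (simp add: eq)
  have nn: "AE x in M. 0 \<le> f x / ?Z" using f Z by simp
  have "integrable M (\<lambda>x. (f x / ?Z) *\<^sub>R g x)"
    using g nn unfolding eq by (subst (asm) integrable_density) auto
  then have "integrable M (\<lambda>x. ?Z * ((f x / ?Z) *\<^sub>R g x))" by (rule integrable_mult_right)
  then show "integrable M (\<lambda>x. f x * g x)" using Z by simp
  have "(\<integral>x. g x \<partial>\<nu>) = (\<integral>x. (f x / ?Z) *\<^sub>R g x \<partial>M)"
    using nn by (subst eq, subst integral_density) auto
  also have "\<dots> = (\<integral>x. f x * g x \<partial>M) / ?Z" by simp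
  finally show "(\<integral>x. f x * g x \<partial>M) = ?Z * (\<integral>x. g x \<partial>\<nu>)" using Z by simp
qed

text \<open>A dilation argument in place of integration by parts: contracting towards the minimiser of
  \<open>V\<close> changes the potential by a controlled amount and Lebesgue measure by \<open>s ^ d\<close>; the virial
  inequality is the first order term at \<open>s = 1\<close>.\<close>

lemma log_concave_perturbation_virial:
  fixes V W :: "real ^ 'd \<Rightarrow> real"
  assumes V: "strongly_convex \<alpha> V" and "\<alpha> > 0" and min: "\<And>x. V x\<^sub>0 \<le> V x"
    and W: "\<And>x y. \<bar>W x - W y\<bar> \<le> L * norm (x - y)"
    and \<nu>: "density_proportional \<nu> lborel (\<lambda>x. exp (- V x - W x))" "\<nu> \<in> P2"
  shows "\<alpha> * (\<integral>x. (norm (x - x\<^sub>0))\<^sup>2 \<partial>\<nu>) - L * (\<integral>x. norm (x - x\<^sub>0) \<partial>\<nu>) \<le> CARD('d)"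
proof -
  interpret prob_space \<nu> using P2D[OF \<nu>(2)] by simp
  define m1 m2 where "m1 = (\<integral>x. norm (x - x\<^sub>0) \<partial>\<nu>)" and "m2 = (\<integral>x. (norm (x - x\<^sub>0))\<^sup>2 \<partial>\<nu>)"
  define f where "f x = exp (- V x - W x)" for x
  define Z where "Z = (\<integral>x. f x \<partial>lborel)"
  have f: "integrable lborel f" and Z: "Z > 0"
    using \<nu>(1) unfolding density_proportional_def f_def[abs_def] Z_def by auto
  define Q where "Q \<epsilon> = \<alpha> * (1 - \<epsilon>) * m2 - L * m1" for \<epsilon>
  define d where "d = CARD('d)"
  have dilate: "(1 - \<epsilon>) ^ d * (1 + \<epsilon> * Q \<epsilon>) \<le> 1" if \<epsilon>: "\<epsilon> \<in> {0<..<1}" for \<epsilon>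
  proof -
    define s where "s = 1 - \<epsilon>"
    have s: "s \<in> {0<..<1}" using \<epsilon> by (simp add: s_def)
    define q where "q x = \<alpha> * s * (norm (x - x\<^sub>0))\<^sup>2 - L * norm (x - x\<^sub>0)" for x
    have q_int: "integrable \<nu> (\<lambda>x. 1 + \<epsilon> * q x)"
      using P2_integrable_norm[OF \<nu>(2)] by (simp add: q_def)
    have q_eq: "(\<integral>x. 1 + \<epsilon> * q x \<partial>\<nu>) = 1 + \<epsilon> * Q \<epsilon>"
      using P2_integrable_norm[OF \<nu>(2)] prob_space by (simp add: q_def Q_def m1_def m2_def s_def)
    \<comment> \<open>The exponential is bounded below by its tangent line, so that after
      integration only the first two moments of \<open>\<nu>\<close> occur.\<close>
    have pw: "f x * (1 + \<epsilon> * q x) \<le> f (\<epsilon> *\<^sub>R x\<^sub>0 + s *\<^sub>R x)" for x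
    proof -
      have "V (\<epsilon> *\<^sub>R x\<^sub>0 + s *\<^sub>R x) \<le> V x - \<epsilon> * (\<alpha> * s * (norm (x - x\<^sub>0))\<^sup>2)"
        using strongly_convex_contract_le[OF V min, of s x] s by (simp add: s_def)
      moreover have "W (\<epsilon> *\<^sub>R x\<^sub>0 + s *\<^sub>R x) \<le> W x + \<epsilon> * (L * norm (x - x\<^sub>0))"
      proof -
        have "\<epsilon> *\<^sub>R x\<^sub>0 + s *\<^sub>R x - x = \<epsilon> *\<^sub>R (x\<^sub>0 - x)" by (simp add: s_def algebra_simps)
        then have "norm (\<epsilon> *\<^sub>R x\<^sub>0 + s *\<^sub>R x - x) = \<epsilon> * norm (x - x\<^sub>0)"
          using \<epsilon> by (simp add: norm_minus_commute)
        then show ?thesis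
          using W[of "\<epsilon> *\<^sub>R x\<^sub>0 + s *\<^sub>R x" x] by (simp add: mult_ac)
      qed
      ultimately have "- V x - W x + \<epsilon> * q x \<le> - V (\<epsilon> *\<^sub>R x\<^sub>0 + s *\<^sub>R x) - W (\<epsilon> *\<^sub>R x\<^sub>0 + s *\<^sub>R x)"
        by (simp add: q_def right_diff_distrib)
      then have "f x * exp (\<epsilon> * q x) \<le> f (\<epsilon> *\<^sub>R x\<^sub>0 + s *\<^sub>R x)"
        unfolding f_def by (simp flip: exp_add)
      moreover have "f x * (1 + \<epsilon> * q x) \<le> f x * exp (\<epsilon> * q x)"
        by (intro mult_left_mono exp_ge_add_one_self) (simp add: f_def)
      ultimately show ?thesis by linarith
    qed
    have "Z * (1 + \<epsilon> * Q \<epsilon>) = (\<integral>x. f x * (1 + \<epsilon> * q x) \<partial>lborel)"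
      using integral_density_proportional(2)[OF \<nu>(1) _ q_int] by (simp add: q_eq f_def Z_def)
    also have "\<dots> \<le> (\<integral>x. f (\<epsilon> *\<^sub>R x\<^sub>0 + s *\<^sub>R x) \<partial>lborel)"
      using integral_density_proportional(1)[OF \<nu>(1) _ q_int] lborel_scale(1)[OF f, of s] s
      by (intro integral_mono pw) (auto simp: f_def)
    finally have "s ^ d * (Z * (1 + \<epsilon> * Q \<epsilon>)) \<le> s ^ d * (\<integral>x. f (\<epsilon> *\<^sub>R x\<^sub>0 + s *\<^sub>R x) \<partial>lborel)"
      using s by (intro mult_left_mono) auto
    also have "\<dots> = Z" using lborel_scale(2)[OF f, of s] s by (simp add: Z_def d_def)
    finally have "Z * (s ^ d * (1 + \<epsilon> * Q \<epsilon>)) \<le> Z * 1" by (simp add: mult_ac)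
    then show ?thesis using Z by (simp add: s_def)
  qed
  \<comment> \<open>Bernoulli's inequality makes the power of 1 - \<epsilon> linear before dividing
    by \<epsilon>. It is multiplied by 1 + \<epsilon> Q, which must be nonnegative for this;
    otherwise Q is negative and so is the left-hand side.\<close>
  have *: "(1 - d * \<epsilon>) * Q \<epsilon> \<le> d" if \<epsilon>: "\<epsilon> \<in> {0<..<1 / d}" for \<epsilon> :: real
  proof (cases "1 + \<epsilon> * Q \<epsilon> \<ge> 0")
    case True
    have "d \<ge> 1" by (simp add: d_def Suc_leI)
    then have "1 / d \<le> 1" by simp
    then have \<epsilon>1: "\<epsilon> \<in> {0<..<1}" using \<epsilon> by auto
    have "1 + real d * (- \<epsilon>) \<le> (1 + (- \<epsilon>)) ^ d"
      using \<epsilon>1 by (intro Bernoulli_inequality) auto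
    then have "(1 - d * \<epsilon>) * (1 + \<epsilon> * Q \<epsilon>) \<le> (1 - \<epsilon>) ^ d * (1 + \<epsilon> * Q \<epsilon>)"
      using True by (intro mult_right_mono) auto
    with dilate[OF \<epsilon>1] have "\<epsilon> * ((1 - d * \<epsilon>) * Q \<epsilon>) \<le> \<epsilon> * d" by (simp add: algebra_simps)
    then show ?thesis using \<epsilon> by simp
  next
    case False
    have "real d > 0" by (simp add: d_def)
    then have "1 - d * \<epsilon> > 0" using \<epsilon> by (simp add: pos_less_divide_eq mult.commute)
    moreover have "Q \<epsilon> < 0"
    proof (rule ccontr)
      assume "\<not> Q \<epsilon> < 0"
      then have "0 \<le> \<epsilon> * Q \<epsilon>" using \<epsilon> by auto
      with False show False by simp
    qed
    ultimately have "(1 - d * \<epsilon>) * Q \<epsilon> < 0" by (rule mult_pos_neg)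
    also have "0 \<le> real d" by simp
    finally show ?thesis by simp
  qed
  have "((\<lambda>\<epsilon>. (1 - real d * \<epsilon>) * Q \<epsilon>) \<longlongrightarrow> (1 - real d * 0) * (\<alpha> * (1 - 0) * m2 - L * m1)) (at_right 0)"
    unfolding Q_def by (intro tendsto_intros)
  moreover have "\<forall>\<^sub>F \<epsilon> in at_right 0. (1 - real d * \<epsilon>) * Q \<epsilon> \<le> real d"
  proof -
    have "0 < 1 / real d" by (simp add: d_def)
    then have "\<forall>\<^sub>F \<epsilon> in at_right 0. \<epsilon> \<in> {0<..<1 / real d}" by (rule eventually_at_right_real)
    then show ?thesis by eventually_elim (rule *)
  qed
  ultimately have "(1 - real d * 0) * (\<alpha> * (1 - 0) * m2 - L * m1) \<le> d"
    by (rule tendsto_upperbound) simp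
  then show ?thesis by (simp add: m1_def m2_def d_def)
qed

text \<open>After doubling the virial bound \<alpha> m2 - L m1 <= d, half of its leading term
  absorbs the linear one by 2 \<alpha> L m1 <= \<alpha>^2 m1^2 + L^2 and m1^2 <= m2. This is the
  origin of the 2 in 2d/\<alpha>; L = 2B/\<sigma>^2 later gives the other summand.\<close>

lemma log_concave_perturbation_variance:
  fixes V W :: "real ^ 'd \<Rightarrow> real"
  assumes V: "strongly_convex \<alpha> V" and \<alpha>: "\<alpha> > 0"
    and W: "\<And>x y. \<bar>W x - W y\<bar> \<le> L * norm (x - y)"
    and \<nu>: "density_proportional \<nu> lborel (\<lambda>x. exp (- V x - W x))" "\<nu> \<in> P2"
  shows "total_variance \<nu> \<le> 2 * CARD('d) / \<alpha> + L\<^sup>2 / \<alpha>\<^sup>2"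
proof -
  interpret prob_space \<nu> using P2D[OF \<nu>(2)] by simp
  obtain x\<^sub>0 where min: "\<And>x. V x\<^sub>0 \<le> V x" using strongly_convex_attains_min[OF V \<alpha>] by blast
  define m1 m2 where "m1 = (\<integral>x. norm (x - x\<^sub>0) \<partial>\<nu>)" and "m2 = (\<integral>x. (norm (x - x\<^sub>0))\<^sup>2 \<partial>\<nu>)"
  have virial: "\<alpha> * m2 - L * m1 \<le> CARD('d)"
    unfolding m1_def m2_def by (rule log_concave_perturbation_virial[OF V \<alpha> min W \<nu>])
  have "m1\<^sup>2 \<le> m2" unfolding m1_def m2_def by (rule integral_norm_sq_le[OF \<nu>(2)])
  then have "\<alpha>\<^sup>2 * m1\<^sup>2 \<le> \<alpha>\<^sup>2 * m2" by (rule mult_left_mono) simp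
  moreover have "0 \<le> (\<alpha> * m1 - L)\<^sup>2" by simp
  moreover have "2 * \<alpha> * (\<alpha> * m2 - L * m1) \<le> 2 * \<alpha> * CARD('d)"
    using virial \<alpha> by (intro mult_left_mono) auto
  ultimately have "\<alpha>\<^sup>2 * m2 \<le> 2 * \<alpha> * CARD('d) + L\<^sup>2"
    by (simp add: power2_diff power_mult_distrib algebra_simps power2_eq_square)
  then have "m2 \<le> (2 * \<alpha> * CARD('d) + L\<^sup>2) / \<alpha>\<^sup>2"
    using \<alpha> by (simp add: pos_le_divide_eq mult.commute)
  also have "\<dots> = 2 * CARD('d) / \<alpha> + L\<^sup>2 / \<alpha>\<^sup>2"
    using \<alpha> by (simp add: add_divide_distrib power2_eq_square)
  finally show ?thesis
    using integral_norm_diff_sq[OF \<nu>(2), of x\<^sub>0] unfolding m2_def[symmetric]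
    by (metis add_increasing2 order_refl order_trans zero_le_power2)
qed

section \<open>Variance from the Poincare inequality\<close>

text \<open>The functions \<open>p(1/s) exp(-1/s)\<close> with \<open>p\<close> a polynomial, extended by \<open>0\<close> to \<open>s \<le> 0\<close>, form a
  family closed under differentiation.\<close>

definition flat :: "real poly \<Rightarrow> real \<Rightarrow> real" where
  "flat p s = (if s > 0 then poly p (1 / s) * exp (- (1 / s)) else 0)"

text \<open>With u = 1/s, the derivative in s of p(u) exp(-u) is u^2 (p(u) - p'(u)) exp(-u).\<close>

definition flat_deriv :: "real poly \<Rightarrow> real poly" where
  "flat_deriv p = monom 1 2 * (p - pderiv p)"

lemma poly_exp_tendsto_0: "((\<lambda>x::real. poly p x * exp (- x)) \<longlongrightarrow> 0) at_top"
proof -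
  have "((\<lambda>x::real. \<Sum>i\<le>degree p. coeff p i * (x ^ i / exp x)) \<longlongrightarrow> (\<Sum>i\<le>degree p. coeff p i * 0)) at_top"
    by (intro tendsto_sum tendsto_mult tendsto_const tendsto_power_div_exp_0)
  then show ?thesis
    by (simp add: poly_altdef exp_minus divide_inverse sum_distrib_right mult.assoc)
qed

lemma flat_tendsto_0: "(flat p \<longlongrightarrow> 0) (at 0)"
proof (rule filterlim_split_at)
  have "\<forall>\<^sub>F s in at_left 0. 0 = flat p s"
    by (auto simp: eventually_at_filter flat_def)
  then show "(flat p \<longlongrightarrow> 0) (at_left 0)" by (rule tendsto_eventually[OF eventually_mono]) auto
  have "((\<lambda>s. poly p (inverse s) * exp (- inverse s)) \<longlongrightarrow> 0) (at_right 0)"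
    by (rule filterlim_compose[OF poly_exp_tendsto_0 filterlim_inverse_at_top_right])
  moreover have "\<forall>\<^sub>F s in at_right 0. poly p (inverse s) * exp (- inverse s) = flat p s"
    by (auto simp: eventually_at_filter flat_def inverse_eq_divide)
  ultimately show "(flat p \<longlongrightarrow> 0) (at_right 0)" by (rule Lim_transform_eventually)
qed

lemma DERIV_flat: "(flat p has_real_derivative flat (flat_deriv p) s) (at s)"
proof (cases s "0 :: real" rule: linorder_cases)
  case less
  have "((\<lambda>_. 0) has_real_derivative 0) (at s)" by simp
  then have "(flat p has_real_derivative 0) (at s)"
    by (rule has_field_derivative_transform_within_open[OF _ open_lessThan]) (use less in \<open>auto simp: flat_def\<close>)
  with less show ?thesis by (simp add: flat_def)
next
  case equal
  have "((\<lambda>h. (flat p h - flat p 0) / (h - 0)) \<longlongrightarrow> 0) (at 0)"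
  \<comment> \<open>Dividing by h multiplies the polynomial by its variable, so the difference
    quotient at 0 is again a member of the family, given by \<open>pCons 0 p\<close>.\<close>
  proof (rule Lim_transform_eventually[OF flat_tendsto_0])
    show "\<forall>\<^sub>F h in at 0. flat (pCons 0 p) h = (flat p h - flat p 0) / (h - 0)"
      by (auto simp: eventually_at_filter flat_def)
  qed
  then show ?thesis unfolding has_field_derivative_iff equal by (simp add: flat_def)
next
  case greater
  have "((\<lambda>s. poly p (1 / s) * exp (- (1 / s))) has_real_derivative
      poly (pderiv p) (1 / s) * (- 1 / s\<^sup>2) * exp (- (1 / s)) + exp (- (1 / s)) * (1 / s\<^sup>2) * poly p (1 / s)) (at s)"
    using greater
    by (auto intro!: derivative_eq_intros DERIV_chain2[OF poly_DERIV] simp: power2_eq_square field_simps)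
  also have "poly (pderiv p) (1 / s) * (- 1 / s\<^sup>2) * exp (- (1 / s)) + exp (- (1 / s)) * (1 / s\<^sup>2) * poly p (1 / s)
      = flat (flat_deriv p) s"
    using greater by (simp add: flat_def flat_deriv_def poly_monom power_divide algebra_simps)
  finally show ?thesis
    by (rule has_field_derivative_transform_within_open[OF _ open_greaterThan]) (use greater in \<open>auto simp: flat_def\<close>)
qed

section \<open>Closure properties of the classes \<open>C_k\<close>\<close>

lemma C_k_Suc_imp: "C_k (Suc k) f \<Longrightarrow> C_k k f"
proof (induction k arbitrary: f)
  case 0
  then show ?case by (simp add: differentiable_imp_continuous_on)
next
  case (Suc k)
  have "C_k (Suc k) (\<lambda>x. gradient f x $ i)" for i using Suc.prems by auto
  then show ?case using Suc.IH Suc.prems by simp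
qed

lemma C_k_SucD:
  assumes "C_k (Suc k) f"
  shows "f differentiable (at x)" "C_k k (\<lambda>x. gradient f x $ i)"
  using assms by (auto simp: differentiable_on_def)

lemma C_k_SucI:
  fixes f :: "real ^ 'd \<Rightarrow> real"
  assumes "\<And>x. (f has_derivative (\<lambda>h. g x \<bullet> h)) (at x)" "\<And>i. C_k k (\<lambda>x. g x $ i)"
  shows "C_k (Suc k) f"
proof -
  have "gradient f x = g x" for x using assms(1) by (rule gradient_eqI)
  with assms show ?thesis by (auto simp: differentiable_on_def differentiable_def)
qed

lemma has_derivative_zero_vec: "((\<lambda>_. c) has_derivative (\<lambda>h. 0 \<bullet> h)) (at (x :: real ^ 'd))"
  by simp

lemma C_k_const: "C_k k (\<lambda>_::real ^ 'd. c)"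
proof (induction k arbitrary: c)
  case (Suc k)
  show ?case by (rule C_k_SucI[OF has_derivative_zero_vec]) (simp add: Suc)
qed simp

lemma C_k_component: "C_k k (\<lambda>x :: real ^ 'd. x $ j)"
proof (cases k)
  case (Suc n)
  have "((\<lambda>x. x $ j) has_derivative (\<lambda>h. axis j 1 \<bullet> h)) (at (x :: real ^ 'd))" for x
    by (simp add: inner_axis' bounded_linear_imp_has_derivative bounded_linear_vec_nth)
  then show ?thesis unfolding Suc by (rule C_k_SucI) (rule C_k_const)
qed (simp add: continuous_intros)

lemma C_k_add: "C_k k f \<Longrightarrow> C_k k g \<Longrightarrow> C_k k (\<lambda>x. f x + g x)"
proof (induction k arbitrary: f g)
  case (Suc k)
  show ?case
  proof (rule C_k_SucI)
    show "((\<lambda>x. f x + g x) has_derivative (\<lambda>h. (gradient f x + gradient g x) \<bullet> h)) (at x)" for x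
      unfolding inner_add_left by (intro derivative_intros has_derivative_gradient C_k_SucD(1)[OF Suc.prems(1)] C_k_SucD(1)[OF Suc.prems(2)])
    show "C_k k (\<lambda>x. (gradient f x + gradient g x) $ i)" for i
      using Suc.IH Suc.prems[THEN C_k_SucD(2)] by simp
  qed
qed (simp add: continuous_intros)

lemma has_derivative_mult_gradient:
  fixes f g :: "real ^ 'd \<Rightarrow> real"
  assumes "f differentiable (at x)" "g differentiable (at x)"
  shows "((\<lambda>x. f x * g x) has_derivative (\<lambda>h. (f x *\<^sub>R gradient g x + g x *\<^sub>R gradient f x) \<bullet> h)) (at x)"
  using has_derivative_mult[OF has_derivative_gradient[OF assms(1)] has_derivative_gradient[OF assms(2)]]
  by (simp add: inner_add_left mult.commute)

lemma C_k_mult: "C_k k f \<Longrightarrow> C_k k g \<Longrightarrow> C_k k (\<lambda>x. f x * g x)"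
proof (induction k arbitrary: f g)
  case (Suc k)
  show ?case
  proof (rule C_k_SucI)
    show "((\<lambda>x. f x * g x) has_derivative (\<lambda>h. (f x *\<^sub>R gradient g x + g x *\<^sub>R gradient f x) \<bullet> h)) (at x)" for x
      by (intro has_derivative_mult_gradient C_k_SucD(1)[OF Suc.prems(1)] C_k_SucD(1)[OF Suc.prems(2)])
    show "C_k k (\<lambda>x. (f x *\<^sub>R gradient g x + g x *\<^sub>R gradient f x) $ i)" for i
      using Suc.IH Suc.prems[THEN C_k_SucD(2)] Suc.prems[THEN C_k_Suc_imp] by (simp add: C_k_add)
  qed
qed (simp add: continuous_intros)

lemma has_derivative_flat_comp:
  fixes u :: "real ^ 'd \<Rightarrow> real"
  assumes "u differentiable (at x)"
  shows "((\<lambda>x. flat p (u x)) has_derivative (\<lambda>h. (flat (flat_deriv p) (u x) *\<^sub>R gradient u x) \<bullet> h)) (at x)"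
  using has_derivative_compose[OF has_derivative_gradient[OF assms] DERIV_flat[unfolded has_field_derivative_def]]
  by simp

lemma continuous_on_flat: "continuous_on S (flat p)"
  by (meson DERIV_flat DERIV_isCont continuous_at_imp_continuous_on)

text \<open>The induction has to vary p, since the gradient of the composition contains
  \<open>flat_deriv p\<close>; with one fixed profile it would not close.\<close>

lemma C_k_flat: "C_k k u \<Longrightarrow> C_k k (\<lambda>x. flat p (u x))"
proof (induction k arbitrary: u p)
  case 0
  then show ?case by (auto intro: continuous_on_compose2[OF continuous_on_flat])
next
  case (Suc k)
  show ?case
  proof (rule C_k_SucI)
    show "((\<lambda>x. flat p (u x)) has_derivative (\<lambda>h. (flat (flat_deriv p) (u x) *\<^sub>R gradient u x) \<bullet> h)) (at x)" for x
      by (intro has_derivative_flat_comp C_k_SucD(1)[OF Suc.prems])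
    show "C_k k (\<lambda>x. (flat (flat_deriv p) (u x) *\<^sub>R gradient u x) $ i)" for i
      using Suc.IH Suc.prems[THEN C_k_SucD(2)] Suc.prems[THEN C_k_Suc_imp] by (simp add: C_k_mult)
  qed
qed

lemma has_derivative_paraboloid:
  "((\<lambda>x. 1 - c * (norm x)\<^sup>2) has_derivative (\<lambda>h. ((- 2 * c) *\<^sub>R x) \<bullet> h)) (at (x :: real ^ 'd))"
  unfolding power2_norm_eq_inner
  by (auto intro!: derivative_eq_intros simp: inner_commute)

lemma C_k_paraboloid: "C_k k (\<lambda>x :: real ^ 'd. 1 - c * (norm x)\<^sup>2)"
proof (cases k)
  case (Suc n)
  show ?thesis unfolding Suc
  proof (rule C_k_SucI[OF has_derivative_paraboloid])
    show "C_k n (\<lambda>x. ((- 2 * c) *\<^sub>R x) $ i)" for i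
      using C_k_mult[OF C_k_const C_k_component, of n "- 2 * c" i] by simp
  qed
qed (simp add: continuous_intros)

text \<open>For p = 1 the derivative is u^2 exp(-u) with u = 1/s, and exp u >= u^2/2 gives the
  2.\<close>

lemma flat_bounds: "\<bar>flat 1 s\<bar> \<le> 1" "\<bar>flat (flat_deriv 1) s\<bar> \<le> 2"
proof -
  show "\<bar>flat 1 s\<bar> \<le> 1" by (simp add: flat_def)
  have "x\<^sup>2 * exp (- x) \<le> 2" if "x \<ge> 0" for x :: real
  proof -
    have "x\<^sup>2 \<le> 2 * exp x" using exp_lower_Taylor_quadratic[OF that] that by simp
    then show ?thesis by (simp add: exp_minus field_simps)
  qed
  from this[of "1 / s"] show "\<bar>flat (flat_deriv 1) s\<bar> \<le> 2"
    by (simp add: flat_def flat_deriv_def poly_monom abs_mult power_divide)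
qed

text \<open>Vanishes outside the ball of radius 1/sqrt c and tends to exp(-1) times the coordinate
  as c decreases to 0. The factor is left unnormalised, since its square cancels in the Poincare
  inequality.\<close>

definition cutoff_coordinate :: "'d \<Rightarrow> real \<Rightarrow> real ^ 'd \<Rightarrow> real" where
  "cutoff_coordinate j c x = x $ j * flat 1 (1 - c * (norm x)\<^sup>2)"

lemma smooth_cutoff_coordinate:
  assumes "c > 0"
  shows "smooth_compact_support (cutoff_coordinate j c)"
proof -
  have "norm x \<le> 1 / sqrt c" if "cutoff_coordinate j c x \<noteq> 0" for x
  proof -
    have "c * (norm x)\<^sup>2 \<le> 1"
      using that by (auto simp: cutoff_coordinate_def flat_def split: if_splits)
    then have "(norm x)\<^sup>2 \<le> 1 / c" using assms by (simp add: field_simps)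
    then have "norm x \<le> sqrt (1 / c)" by (rule real_le_rsqrt)
    then show ?thesis by (simp add: real_sqrt_divide)
  qed
  then have "{x. cutoff_coordinate j c x \<noteq> 0} \<subseteq> cball 0 (1 / sqrt c)" by auto
  then have "compact (closure {x. cutoff_coordinate j c x \<noteq> 0})"
    using bounded_cball bounded_subset compact_closure by blast
  moreover have "C_k k (cutoff_coordinate j c)" for k
    unfolding cutoff_coordinate_def[abs_def]
    by (intro C_k_mult C_k_component C_k_flat C_k_paraboloid)
  ultimately show ?thesis by (simp add: smooth_compact_support_def)
qed

lemma gradient_cutoff_coordinate:
  "gradient (cutoff_coordinate j c) x = flat 1 (1 - c * (norm x)\<^sup>2) *\<^sub>R axis j 1
     + (x $ j * flat (flat_deriv 1) (1 - c * (norm x)\<^sup>2)) *\<^sub>R ((- 2 * c) *\<^sub>R x)"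
proof -
  have par: "(\<lambda>x. 1 - c * (norm x)\<^sup>2) differentiable (at x)"
    using has_derivative_paraboloid by (rule differentiableI)
  have comp: "((\<lambda>x. x $ j) has_derivative (\<lambda>h. axis j 1 \<bullet> h)) (at x)"
    by (simp add: inner_axis' bounded_linear_imp_has_derivative bounded_linear_vec_nth)
  show ?thesis unfolding cutoff_coordinate_def[abs_def]
    using has_derivative_mult[OF comp has_derivative_flat_comp[OF par, of 1]]
    by (intro gradient_eqI) (simp add: gradient_eqI[OF has_derivative_paraboloid] inner_add_left algebra_simps)
qed

text \<open>Uniform in c, as dominated convergence requires: the gradient of the cutoff is of size c
  |x| and is multiplied by at most |x|, while c |x|^2 < 1 wherever it is nonzero. The 5 is 1 from
  the coordinate plus 4 c |x|^2 from the cutoff.\<close>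

lemma norm_gradient_cutoff_coordinate_le:
  fixes x :: "real ^ 'd"
  assumes "c > 0"
  shows "norm (gradient (cutoff_coordinate j c) x) \<le> 5"
proof (cases "c * (norm x)\<^sup>2 < 1")
  case False
  then show ?thesis by (simp add: gradient_cutoff_coordinate flat_def)
next
  case True
  have "norm (gradient (cutoff_coordinate j c) x) \<le> \<bar>flat 1 (1 - c * (norm x)\<^sup>2)\<bar> * norm (axis j 1 :: real ^ 'd)
     + \<bar>x $ j\<bar> * \<bar>flat (flat_deriv 1) (1 - c * (norm x)\<^sup>2)\<bar> * (2 * c * norm x)"
    unfolding gradient_cutoff_coordinate using assms
    by (intro order_trans[OF norm_triangle_ineq]) (simp add: abs_mult)
  also have "\<dots> \<le> 1 * 1 + norm x * 2 * (2 * c * norm x)"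
    using assms by (intro add_mono mult_mono flat_bounds component_le_norm_cart) (auto simp: norm_axis_1)
  also have "\<dots> = 1 + 4 * (c * (norm x)\<^sup>2)" by (simp add: power2_eq_square)
  also have "\<dots> \<le> 5" using True by simp
  finally show ?thesis .
qed

text \<open>The inequality is applied to truncated coordinates with c = 1/(n+1). In the limit,
  domination comes from the finite second moment on the left and from the uniform gradient bound on
  the right.\<close>

lemma poincare_coordinate_variance:
  fixes \<nu> :: "(real ^ 'd) measure"
  assumes PI: "poincare C \<nu>" and \<nu>: "\<nu> \<in> P2"
  shows "(\<integral>x. (x $ j - (\<integral>y. y $ j \<partial>\<nu>))\<^sup>2 \<partial>\<nu>) \<le> C"
proof -
  interpret prob_space \<nu> using P2D[OF \<nu>] by simp
  note [measurable_cong] = P2D(2)[OF \<nu>]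
  define c where "c n = inverse (real (Suc n))" for n
  define f where "f n = cutoff_coordinate j (c n)" for n
  define e where "e = exp (- 1 :: real)"
  have c_pos: "c n > 0" for n by (simp add: c_def)
  have c_lim: "c \<longlonglongrightarrow> 0" unfolding c_def by (rule LIMSEQ_inverse_real_of_nat)
  have u_lim: "(\<lambda>n. 1 - c n * (norm x)\<^sup>2) \<longlonglongrightarrow> 1" for x :: "real ^ 'd"
    using tendsto_diff[OF tendsto_const tendsto_mult[OF c_lim tendsto_const]] by simp
  have flat_lim: "(\<lambda>n. flat p (1 - c n * (norm x)\<^sup>2)) \<longlonglongrightarrow> poly p 1 * e" for p and x :: "real ^ 'd"
    using isCont_tendsto_compose[OF DERIV_isCont[OF DERIV_flat] u_lim] by (simp add: flat_def e_def)
  have f_lim: "(\<lambda>n. f n x) \<longlonglongrightarrow> x $ j * e" for x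
    unfolding f_def cutoff_coordinate_def using tendsto_mult[OF tendsto_const flat_lim[of 1 x]] by simp
  have f_le: "\<bar>f n x\<bar> \<le> norm x" for n x
  proof -
    have "\<bar>x $ j\<bar> * \<bar>flat 1 (1 - c n * (norm x)\<^sup>2)\<bar> \<le> norm x * 1"
      by (intro mult_mono flat_bounds component_le_norm_cart) auto
    then show ?thesis by (simp add: f_def cutoff_coordinate_def abs_mult)
  qed
  have [measurable]: "flat p \<in> borel_measurable borel" for p
    by (rule borel_measurable_continuous_onI[OF continuous_on_flat])
  have [measurable]: "(\<lambda>x :: real ^ 'd. x $ i) \<in> borel_measurable borel" for i
    by (intro borel_measurable_continuous_onI continuous_intros)
  have [measurable]: "f n \<in> borel_measurable borel" for n
    unfolding f_def cutoff_coordinate_def[abs_def] by measurable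
  have norm_int: "integrable \<nu> norm" "integrable \<nu> (\<lambda>x. (norm x)\<^sup>2)"
    using P2_integrable_norm[OF \<nu>, of 0] by simp_all
  define a where "a n = (\<integral>x. f n x \<partial>\<nu>)" for n
  define A where "A = (\<integral>x. norm x \<partial>\<nu>)"
  have a_lim: "a \<longlonglongrightarrow> (\<integral>x. x $ j * e \<partial>\<nu>)"
    unfolding a_def
    by (rule integral_dominated_convergence[where w = norm]) (use f_lim f_le norm_int in auto)
  have a_le: "\<bar>a n\<bar> \<le> A" for n
  proof -
    have "\<bar>a n\<bar> \<le> (\<integral>x. \<bar>f n x\<bar> \<partial>\<nu>)" unfolding a_def by (rule integral_abs_bound)
    also have "\<dots> \<le> A" unfolding A_def by (rule integral_mono') (use f_le norm_int in auto)
    finally show ?thesis .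
  qed
  have "(\<lambda>n. \<integral>x. (f n x - a n)\<^sup>2 \<partial>\<nu>) \<longlonglongrightarrow> (\<integral>x. (x $ j * e - (\<integral>x. x $ j * e \<partial>\<nu>))\<^sup>2 \<partial>\<nu>)"
  proof (rule integral_dominated_convergence[where w = "\<lambda>x. 2 * (norm x)\<^sup>2 + 2 * A\<^sup>2"])
    show "AE x in \<nu>. (\<lambda>n. (f n x - a n)\<^sup>2) \<longlonglongrightarrow> (x $ j * e - (\<integral>x. x $ j * e \<partial>\<nu>))\<^sup>2"
      by (intro AE_I2 tendsto_intros f_lim a_lim)
    have "(f n x - a n)\<^sup>2 \<le> 2 * (norm x)\<^sup>2 + 2 * A\<^sup>2" for n x
    proof -
      have "(f n x - a n)\<^sup>2 \<le> 2 * (f n x)\<^sup>2 + 2 * (a n)\<^sup>2"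
        using zero_le_power2[of "f n x + a n"] unfolding power2_sum power2_diff by linarith
      also have "\<dots> \<le> 2 * (norm x)\<^sup>2 + 2 * A\<^sup>2"
        using power_mono[OF f_le[of n x], of 2] power_mono[OF a_le[of n], of 2] by simp
      finally show ?thesis .
    qed
    then show "AE x in \<nu>. norm ((f n x - a n)\<^sup>2) \<le> 2 * (norm x)\<^sup>2 + 2 * A\<^sup>2" for n by simp
  qed (use norm_int in auto)
  also have "(\<integral>x. (x $ j * e - (\<integral>x. x $ j * e \<partial>\<nu>))\<^sup>2 \<partial>\<nu>) = e\<^sup>2 * (\<integral>x. (x $ j - (\<integral>y. y $ j \<partial>\<nu>))\<^sup>2 \<partial>\<nu>)"
    by (simp add: power_mult_distrib flip: left_diff_distrib)
  finally have lhs: "(\<lambda>n. \<integral>x. (f n x - a n)\<^sup>2 \<partial>\<nu>) \<longlonglongrightarrow> e\<^sup>2 * (\<integral>x. (x $ j - (\<integral>y. y $ j \<partial>\<nu>))\<^sup>2 \<partial>\<nu>)" .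
  have "(\<lambda>n. \<integral>x. (norm (gradient (f n) x))\<^sup>2 \<partial>\<nu>) \<longlonglongrightarrow> (\<integral>x. e\<^sup>2 \<partial>\<nu>)"
  proof (rule integral_dominated_convergence[where w = "\<lambda>_. 25"])
    \<comment> \<open>The term coming from the gradient of the cutoff carries the factor
      \<open>c n\<close> and disappears.\<close>
    have "(\<lambda>n. gradient (f n) x) \<longlonglongrightarrow> (poly 1 1 * e) *\<^sub>R axis j 1
        + (x $ j * (poly (flat_deriv 1) 1 * e)) *\<^sub>R ((- 2 * 0) *\<^sub>R x)" for x
      unfolding f_def gradient_cutoff_coordinate
      by (intro tendsto_intros flat_lim c_lim)
    from tendsto_power[OF tendsto_norm[OF this]]
    show "AE x in \<nu>. (\<lambda>n. (norm (gradient (f n) x))\<^sup>2) \<longlonglongrightarrow> e\<^sup>2"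
      by (intro AE_I2) (simp add: norm_axis_1 e_def)
    have "(norm (gradient (f n) x))\<^sup>2 \<le> 5\<^sup>2" for n x
      unfolding f_def by (intro power_mono norm_gradient_cutoff_coordinate_le c_pos) auto
    then show "AE x in \<nu>. norm ((norm (gradient (f n) x))\<^sup>2) \<le> 25" for n by simp
    show "(\<lambda>x. (norm (gradient (f n) x))\<^sup>2) \<in> borel_measurable \<nu>" for n
      unfolding f_def gradient_cutoff_coordinate by measurable
  qed simp_all
  then have rhs: "(\<lambda>n. C * (\<integral>x. (norm (gradient (f n) x))\<^sup>2 \<partial>\<nu>)) \<longlonglongrightarrow> C * e\<^sup>2"
    using prob_space by (intro tendsto_intros) simp
  have "(\<integral>x. (f n x - a n)\<^sup>2 \<partial>\<nu>) \<le> C * (\<integral>x. (norm (gradient (f n) x))\<^sup>2 \<partial>\<nu>)" for n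
    using PI smooth_cutoff_coordinate[OF c_pos] unfolding poincare_def f_def a_def by blast
  then have "e\<^sup>2 * (\<integral>x. (x $ j - (\<integral>y. y $ j \<partial>\<nu>))\<^sup>2 \<partial>\<nu>) \<le> C * e\<^sup>2"
    using LIMSEQ_le[OF lhs rhs] by blast
  then show ?thesis by (simp add: e_def mult.commute)
qed

lemma poincare_total_variance:
  fixes \<nu> :: "(real ^ 'd) measure"
  assumes PI: "poincare C \<nu>" and \<nu>: "\<nu> \<in> P2"
  shows "total_variance \<nu> \<le> C * CARD('d)"
proof -
  interpret prob_space \<nu> using P2D[OF \<nu>] by simp
  note [measurable_cong] = P2D(2)[OF \<nu>]
  define m where "m = (\<integral>y. y \<partial>\<nu>)"
  have id: "integrable \<nu> (\<lambda>x. x)"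
    using P2_integrable_norm(1)[OF \<nu>, of 0] by (subst (asm) integrable_norm_iff) auto
  have m: "m $ j = (\<integral>y. y $ j \<partial>\<nu>)" for j
    unfolding m_def using integral_bounded_linear[OF bounded_linear_vec_nth id] by simp
  have norm_sq: "(norm v)\<^sup>2 = (\<Sum>j\<in>UNIV. (v $ j)\<^sup>2)" for v :: "real ^ 'd"
    unfolding power2_norm_eq_inner inner_vec_def by (simp add: power2_eq_square)
  have int: "integrable \<nu> (\<lambda>x. (x $ j - m $ j)\<^sup>2)" for j
  proof (rule Bochner_Integration.integrable_bound[OF P2_integrable_norm(2)[OF \<nu>, of m]])
    have "(x $ j - m $ j)\<^sup>2 \<le> (norm (x - m))\<^sup>2" for x
      using power_mono[OF component_le_norm_cart[of "x - m" j], of 2] by simp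
    then show "AE x in \<nu>. norm ((x $ j - m $ j)\<^sup>2) \<le> norm ((norm (x - m))\<^sup>2)" by simp
    have "(\<lambda>x :: real ^ 'd. (x $ j - m $ j)\<^sup>2) \<in> borel_measurable borel"
      by (intro borel_measurable_continuous_onI continuous_intros)
    then show "(\<lambda>x. (x $ j - m $ j)\<^sup>2) \<in> borel_measurable \<nu>" by simp
  qed
  have "total_variance \<nu> = (\<Sum>j\<in>UNIV. \<integral>x. (x $ j - m $ j)\<^sup>2 \<partial>\<nu>)"
    unfolding total_variance_def m_def[symmetric] norm_sq using int by simp
  also have "\<dots> \<le> (\<Sum>j\<in>(UNIV :: 'd set). C)"
    unfolding m by (intro sum_mono poincare_coordinate_variance PI \<nu>)
  finally show ?thesis by (simp add: mult.commute)
qed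

section \<open>Divergence from a product measure\<close>

text \<open>A finite product measure is determined by boxes, and on a box the integral of the
  product density factorises.\<close>

lemma PiM_density:
  fixes f :: "'i \<Rightarrow> 'a \<Rightarrow> ennreal"
  assumes I: "finite I" and M: "\<And>i. sigma_finite_measure (M i)"
    and D: "\<And>i. sigma_finite_measure (density (M i) (f i))"
    and f[measurable]: "\<And>i. f i \<in> borel_measurable (M i)"
  shows "PiM I (\<lambda>i. density (M i) (f i)) = density (PiM I M) (\<lambda>x. \<Prod>i\<in>I. f i (x i))"
proof -
  interpret M: product_sigma_finite M by (rule product_sigma_finite.intro) (rule M)
  interpret D: product_sigma_finite "\<lambda>i. density (M i) (f i)"
    by (rule product_sigma_finite.intro) (rule D)
  have "density (PiM I M) (\<lambda>x. \<Prod>i\<in>I. f i (x i)) = PiM I (\<lambda>i. density (M i) (f i))"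
  proof (rule D.PiM_eqI[OF I])
    show "sets (density (PiM I M) (\<lambda>x. \<Prod>i\<in>I. f i (x i))) = sets (PiM I (\<lambda>i. density (M i) (f i)))"
      by (simp cong: sets_PiM_cong)
    fix A assume "\<And>i. i \<in> I \<Longrightarrow> A i \<in> sets (density (M i) (f i))"
    then have A[measurable]: "\<And>i. i \<in> I \<Longrightarrow> A i \<in> sets (M i)" by simp
    have "emeasure (density (PiM I M) (\<lambda>x. \<Prod>i\<in>I. f i (x i))) (Pi\<^sub>E I A)
        = (\<integral>\<^sup>+x. (\<Prod>i\<in>I. f i (x i)) * indicator (Pi\<^sub>E I A) x \<partial>PiM I M)"
      using A I by (intro emeasure_density sets_PiM_I_finite) auto
    also have "\<dots> = (\<integral>\<^sup>+x. (\<Prod>i\<in>I. f i (x i) * indicator (A i) (x i)) \<partial>PiM I M)"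
    proof (rule nn_integral_cong)
      fix x assume "x \<in> space (PiM I M)"
      \<comment> \<open>Membership in the box also demands the default value outside I; points of
        the product space have it, so the indicator is a product over I.\<close>
      then have "x \<in> extensional I" by (auto simp: space_PiM PiE_iff)
      then have "(indicator (Pi\<^sub>E I A) x :: ennreal) = (\<Prod>i\<in>I. indicator (A i) (x i))"
        using I by (auto simp: indicator_def PiE_iff prod_zero_iff)
      then show "(\<Prod>i\<in>I. f i (x i)) * indicator (Pi\<^sub>E I A) x = (\<Prod>i\<in>I. f i (x i) * indicator (A i) (x i))"
        by (simp add: prod.distrib)
    qed
    also have "\<dots> = (\<Prod>i\<in>I. \<integral>\<^sup>+x. f i x * indicator (A i) x \<partial>M i)"
      using I A by (intro M.product_nn_integral_prod) auto
    also have "\<dots> = (\<Prod>i\<in>I. emeasure (density (M i) (f i)) (A i))"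
      using A by (intro prod.cong refl emeasure_density[symmetric]) auto
    finally show "emeasure (density (PiM I M) (\<lambda>x. \<Prod>i\<in>I. f i (x i))) (Pi\<^sub>E I A)
        = (\<Prod>i\<in>I. emeasure (density (M i) (f i)) (A i))" .
  qed
  then show ?thesis by simp
qed

lemma prob_space_density_proportional:
  assumes \<nu>: "density_proportional \<nu> M f" and f: "\<And>x. f x \<ge> 0"
  shows "prob_space \<nu>"
proof (rule prob_spaceI)
  let ?Z = "\<integral>x. f x \<partial>M"
  have fM: "integrable M f" and Z: "?Z > 0" and eq: "\<nu> = density M (\<lambda>x. ennreal (f x / ?Z))"
    using \<nu> by (auto simp: density_proportional_def)
  have [measurable]: "f \<in> borel_measurable M" using fM by simp
  have "emeasure \<nu> (space \<nu>) = (\<integral>\<^sup>+x. ennreal (f x / ?Z) \<partial>M)"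
    unfolding eq by (simp add: emeasure_density cong: nn_integral_cong)
  also have "\<dots> = ennreal (\<integral>x. f x / ?Z \<partial>M)"
    using fM f Z by (intro nn_integral_eq_integral) auto
  also have "\<dots> = 1" using Z by simp
  finally show "emeasure \<nu> (space \<nu>) = 1" .
qed

text \<open>The normalising constant satisfies \<open>ln c \<le> \<integral>G dQ\<close> by Jensen's inequality, while \<open>G \<ge> 0\<close> lets
  us drop the other term of the divergence.\<close>

lemma (in prob_space) KL_gibbs_le:
  assumes G: "integrable M G" "\<And>x. x \<in> space M \<Longrightarrow> G x \<ge> 0" and c: "c > 0"
    and \<mu>: "\<mu> = density M (\<lambda>x. ennreal (c * exp (- G x)))" "prob_space \<mu>"
  shows "absolutely_continuous M \<mu>" "integrable \<mu> (entropy_density (exp 1) M \<mu>)"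
    "KL_divergence (exp 1) M \<mu> \<le> (\<integral>x. G x \<partial>M)"
proof -
  define h where "h x = c * exp (- G x)" for x
  define m where "m = (\<integral>x. G x \<partial>M)"
  have [measurable]: "G \<in> borel_measurable M" using G by simp
  have h_meas[measurable]: "h \<in> borel_measurable M" unfolding h_def by measurable
  have h_nonneg: "h x \<ge> 0" for x using c by (simp add: h_def)
  have h_le: "h x \<le> c" if "x \<in> space M" for x using c G(2)[OF that] by (simp add: h_def)
  have \<mu>_eq: "\<mu> = density M (\<lambda>x. ennreal (h x))" using \<mu>(1) by (simp add: h_def)
  show "absolutely_continuous M \<mu>"
    unfolding \<mu>_eq by (intro absolutely_continuousI_density) measurable
  have h_int: "integrable M h"
  proof (rule Bochner_Integration.integrable_bound[OF integrable_const])
    show "AE x in M. norm (h x) \<le> norm c"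
      using h_le h_nonneg c by (intro AE_I2) simp
  qed fact
  have "emeasure \<mu> (space \<mu>) = (\<integral>\<^sup>+x. ennreal (h x) \<partial>M)"
    unfolding \<mu>_eq by (simp add: emeasure_density cong: nn_integral_cong)
  also have "\<dots> = ennreal (\<integral>x. h x \<partial>M)"
    using h_int h_nonneg by (intro nn_integral_eq_integral) auto
  finally have h1: "(\<integral>x. h x \<partial>M) = 1"
    using prob_space.emeasure_space_1[OF \<mu>(2)] by (simp add: ennreal_eq_1)
  have "ln c \<le> m"
  proof -
    \<comment> \<open>Jensen's inequality through the tangent line of the exponential at - m,
      integrated against the probability measure M.\<close>
    have "c * exp (- m) = (\<integral>x. c * (exp (- m) * (1 - (G x - m))) \<partial>M)"
      using G prob_space by (simp add: m_def)
    also have "\<dots> \<le> (\<integral>x. h x \<partial>M)"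
    proof (rule integral_mono)
      fix x
      have "1 - (G x - m) \<le> exp (m - G x)"
        using exp_ge_add_one_self[of "m - G x"] by linarith
      then have "exp (- m) * (1 - (G x - m)) \<le> exp (- m) * exp (m - G x)"
        by (rule mult_left_mono) simp
      also have "\<dots> = exp (- G x)" by (simp flip: exp_add)
      finally show "c * (exp (- m) * (1 - (G x - m))) \<le> h x"
        unfolding h_def using c by (intro mult_left_mono) auto
    qed (use G h_int in auto)
    finally have "c \<le> exp m" by (simp add: h1 exp_minus field_simps)
    then show ?thesis using c ln_le_cancel_iff[of c "exp m"] by simp
  qed
  have "density M (RN_deriv M \<mu>) = \<mu>"
    unfolding \<mu>_eq by (intro density_RN_deriv_density) auto
  \<comment> \<open>\<open>KL_divergence\<close> is defined through \<open>RN_deriv\<close>, which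
    is determined only almost everywhere; under the integral sign h takes its place.\<close>
  then have "AE x in M. RN_deriv M \<mu> x = ennreal (h x)"
    unfolding \<mu>_eq by (intro density_unique) auto
  then have ed: "AE x in M. h x * entropy_density (exp 1) M \<mu> x = h x * (ln c - G x)"
  proof eventually_elim
    case (elim x)
    then show ?case
      using h_nonneg c by (simp add: entropy_density_def log_def) (simp add: h_def ln_mult)
  qed
  have [measurable]: "entropy_density (exp 1) M \<mu> \<in> borel_measurable M" by measurable
  \<comment> \<open>Since G is nonnegative, h is at most c, and integrability of G suffices.\<close>
  have int: "integrable M (\<lambda>x. h x * (ln c - G x))"
  proof (rule Bochner_Integration.integrable_bound)
    show "integrable M (\<lambda>x. c * (\<bar>ln c\<bar> + G x))" using G by auto
    show "AE x in M. norm (h x * (ln c - G x)) \<le> norm (c * (\<bar>ln c\<bar> + G x))"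
    proof (rule AE_I2)
      fix x assume x: "x \<in> space M"
      have "\<bar>h x\<bar> * \<bar>ln c - G x\<bar> \<le> c * (\<bar>ln c\<bar> + G x)"
        using h_le[OF x] h_nonneg[of x] G(2)[OF x] c by (intro mult_mono) auto
      then show "norm (h x * (ln c - G x)) \<le> norm (c * (\<bar>ln c\<bar> + G x))"
        unfolding real_norm_def abs_mult[of "h x"] by (rule order_trans[OF _ abs_ge_self])
    qed
  qed measurable
  have "integrable M (\<lambda>x. h x *\<^sub>R entropy_density (exp 1) M \<mu> x)"
    using int ed by (subst integrable_cong_AE[of _ _ "\<lambda>x. h x * (ln c - G x)"]) auto
  then have "integrable (density M (\<lambda>x. ennreal (h x))) (entropy_density (exp 1) M \<mu>)"
    using h_nonneg by (subst integrable_density) auto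
  then show "integrable \<mu> (entropy_density (exp 1) M \<mu>)"
    by (subst (1) \<mu>_eq)
  have "KL_divergence (exp 1) M \<mu> = (\<integral>x. h x *\<^sub>R entropy_density (exp 1) M \<mu> x \<partial>M)"
    unfolding KL_divergence_def using h_nonneg
    by (subst (1) \<mu>_eq, subst integral_density) auto
  also have "\<dots> = (\<integral>x. h x * (ln c - G x) \<partial>M)"
    using ed by (intro integral_cong_AE) auto
  also have "\<dots> \<le> (\<integral>x. h x * ln c \<partial>M)"
    using int h_int h_nonneg G(2) by (intro integral_mono) (auto intro!: mult_left_mono)
  also have "\<dots> = ln c" by (simp add: h1)
  also have "\<dots> \<le> m" by fact
  finally show "KL_divergence (exp 1) M \<mu> \<le> (\<integral>x. G x \<partial>M)" unfolding m_def .
qed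

section \<open>Gibbs density relative to the product measure, and the divergence bound\<close>

context mean_field_product
begin

lemma integral_empirical:
  fixes x :: "nat \<Rightarrow> real ^ 'd"
  assumes f: "\<And>\<rho>. \<rho> \<in> P2 \<Longrightarrow> integrable \<rho> f"
  shows "(\<integral>z. f z \<partial>empirical N x) = (\<Sum>i\<in>{1..N}. f (x i)) / real N"
proof -
  have "(\<integral>z. f z \<partial>partial_empirical {1..N} x)
      = (\<Sum>i\<in>{1..N}. if i \<in> {1..N} then f (x i) else (\<integral>z. f z \<partial>\<pi> i)) / real N"
    by (intro integral_partial_empirical f)
  also have "(\<Sum>i\<in>{1..N}. if i \<in> {1..N} then f (x i) else (\<integral>z. f z \<partial>\<pi> i)) = (\<Sum>i\<in>{1..N}. f (x i))"
    by (intro sum.cong) auto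
  finally show ?thesis unfolding partial_empirical_all .
qed

text \<open>The first two conjuncts give the third its meaning: \<open>KL_divergence\<close> is a
  Bochner integral of the logarithm of \<open>RN_deriv\<close>, so without integrability it would be
  0, and without absolute continuity that derivative would not describe
  \<open>\<mu>\<close>.\<close>

lemma KL_product_le:
  fixes \<sigma> K :: real and V :: "nat \<Rightarrow> real ^ 'd \<Rightarrow> real"
  assumes \<sigma>: "\<sigma> > 0" and V: "\<And>i. V i \<in> borel_measurable borel"
    and \<mu>: "density_proportional \<mu> (PiM {1..N} (\<lambda>_. lborel))
              (\<lambda>x. exp (- (\<Sum>i\<in>{1..N}. V i (x i)) - 2 * real N / \<sigma>\<^sup>2 * F (empirical N x)))"
    and \<pi>_density: "\<And>i. density_proportional (\<pi> i) lborel
              (\<lambda>x. exp (- V i x - 2 / \<sigma>\<^sup>2 * dF (avg_measure N \<pi>) x))"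
    and var: "\<And>i. i \<in> {1..N} \<Longrightarrow> total_variance (\<pi> i) \<le> K"
  shows "absolutely_continuous (PiM {1..N} \<pi>) \<mu> \<and>
         integrable \<mu> (entropy_density (exp 1) (PiM {1..N} \<pi>) \<mu>) \<and>
         KL_divergence (exp 1) (PiM {1..N} \<pi>) \<mu> \<le> 4 * \<beta> / \<sigma>\<^sup>2 * K"
proof -
  let ?M = "PiM {1..N} (\<lambda>_. lborel :: (real ^ 'd) measure)"
  define \<nu> where "\<nu> = avg_measure N \<pi>"
  define g where "g = dF \<nu>"
  define k where "k = 2 * real N / \<sigma>\<^sup>2"
  define a where "a = (\<integral>z. g z \<partial>\<nu>)"
  have N0: "real N > 0" using N by simp
  have \<nu>: "\<nu> \<in> P2" unfolding \<nu>_def by (intro avg_measure_in_P2 N \<pi>)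
  have g_int: "\<rho> \<in> P2 \<Longrightarrow> integrable \<rho> g" for \<rho> unfolding g_def by (rule dF_integrable[OF \<nu>])
  have [measurable]: "g \<in> borel_measurable borel"
    unfolding g_def by (rule lipschitz_borel_measurable[OF dF_lipschitz[OF \<nu>]])
  note [measurable] = V
  have sets_M: "sets ?M = sets (PiM {1..N} (\<lambda>_. borel))"
    by (rule sets_PiM_cong) simp_all
  have F_meas: "(\<lambda>x. F (empirical N x)) \<in> borel_measurable (PiM {1..N} (\<lambda>_. borel))"
    using energy_measurable[of "{1..N}"] unfolding partial_empirical_all .
  have F_int: "integrable (PiM {1..N} \<pi>) (\<lambda>x. F (empirical N x))"
    using energy_integrable[of "{1..N}"] unfolding partial_empirical_all .

  \<comment> \<open>The convexity gap of the energy at \<open>\<nu>\<close>, with the factor k for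
    which k/N = 2/\<sigma>^2 matches the exponent in the laws \<open>\<pi> i\<close>. An additive
    constant in \<open>dF \<nu>\<close> cancels between the sum and a.\<close>
  define G where "G x = k * (F (empirical N x) - F \<nu> - ((\<Sum>i\<in>{1..N}. g (x i)) / N - a))" for x
  have G_meas: "G \<in> borel_measurable (PiM {1..N} (\<lambda>_. borel))"
    unfolding G_def using F_meas by measurable
  have G_nonneg: "G x \<ge> 0" for x
  proof -
    have "(\<integral>z. dF \<nu> z \<partial>empirical N x) - (\<integral>z. dF \<nu> z \<partial>\<nu>) \<le> F (empirical N x) - F \<nu>"
      using N \<nu> by (intro convex_first_variation_le[OF first_var] conv empirical_in_P2)
    moreover have "(\<integral>z. g z \<partial>empirical N x) = (\<Sum>i\<in>{1..N}. g (x i)) / N"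
      by (intro integral_empirical g_int)
    ultimately have "(\<Sum>i\<in>{1..N}. g (x i)) / N - a \<le> F (empirical N x) - F \<nu>"
      unfolding g_def[symmetric] a_def by simp
    then show ?thesis using N0 by (simp add: G_def k_def)
  qed
  have g_comp: "integrable (PiM {1..N} \<pi>) (\<lambda>x. g (x i))"
    "(\<integral>x. g (x i) \<partial>PiM {1..N} \<pi>) = (\<integral>z. g z \<partial>\<pi> i)" if "i \<in> {1..N}" for i
    using integrable_PiM_component[OF that g_int[OF \<pi>]] .
  have g_sum: "integrable (PiM {1..N} \<pi>) (\<lambda>x. (\<Sum>i\<in>{1..N}. g (x i)) / N)"
    using g_comp(1) by (intro integrable_divide_zero Bochner_Integration.integrable_sum)
  \<comment> \<open>The linear part of the gap is centred precisely because \<open>\<nu>\<close> is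
    the average of the laws of the samples.\<close>
  have "(\<integral>x. (\<Sum>i\<in>{1..N}. g (x i)) / N \<partial>PiM {1..N} \<pi>) = (\<integral>x. (\<Sum>i\<in>{1..N}. g (x i)) \<partial>PiM {1..N} \<pi>) / N"
    by (rule integral_divide_zero)
  also have "\<dots> = (\<Sum>i\<in>{1..N}. \<integral>z. g z \<partial>\<pi> i) / N"
    using g_comp by (subst Bochner_Integration.integral_sum) (auto intro!: sum.cong)
  also have "\<dots> = a"
    unfolding a_def \<nu>_def by (rule integral_avg_measure[symmetric]) (auto intro: \<pi> g_int)
  finally have g_avg: "(\<integral>x. (\<Sum>i\<in>{1..N}. g (x i)) / N \<partial>PiM {1..N} \<pi>) = a" .
  have G_int: "integrable (PiM {1..N} \<pi>) G"
    unfolding G_def[abs_def] using F_int g_sum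
    by (intro integrable_mult_right Bochner_Integration.integrable_diff P.integrable_const)
  have "(\<integral>x. G x \<partial>PiM {1..N} \<pi>)
      = k * (\<integral>x. F (empirical N x) - F \<nu> - ((\<Sum>i\<in>{1..N}. g (x i)) / N - a) \<partial>PiM {1..N} \<pi>)"
    unfolding G_def by (rule integral_mult_right_zero)
  also have "(\<integral>x. F (empirical N x) - F \<nu> - ((\<Sum>i\<in>{1..N}. g (x i)) / N - a) \<partial>PiM {1..N} \<pi>)
      = ((\<integral>x. F (empirical N x) \<partial>PiM {1..N} \<pi>) - F \<nu>)
        - ((\<integral>x. (\<Sum>i\<in>{1..N}. g (x i)) / N \<partial>PiM {1..N} \<pi>) - a)"
  proof -
    have const: "(\<integral>x. b \<partial>PiM {1..N} \<pi>) = b" for b :: real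
      using P.prob_space by simp
    have "(\<integral>x. F (empirical N x) - F \<nu> \<partial>PiM {1..N} \<pi>) = (\<integral>x. F (empirical N x) \<partial>PiM {1..N} \<pi>) - F \<nu>"
      using Bochner_Integration.integral_diff[OF F_int P.integrable_const] unfolding const .
    moreover have "(\<integral>x. (\<Sum>i\<in>{1..N}. g (x i)) / N - a \<partial>PiM {1..N} \<pi>)
        = (\<integral>x. (\<Sum>i\<in>{1..N}. g (x i)) / N \<partial>PiM {1..N} \<pi>) - a"
      using Bochner_Integration.integral_diff[OF g_sum P.integrable_const] unfolding const .
    moreover have "integrable (PiM {1..N} \<pi>) (\<lambda>x. F (empirical N x) - F \<nu>)"
      by (intro Bochner_Integration.integrable_diff F_int P.integrable_const)
    moreover have "integrable (PiM {1..N} \<pi>) (\<lambda>x. (\<Sum>i\<in>{1..N}. g (x i)) / N - a)"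
      by (intro Bochner_Integration.integrable_diff g_sum P.integrable_const)
    ultimately show ?thesis by (simp only: Bochner_Integration.integral_diff)
  qed
  also have "k * \<dots> \<le> k * (2 * \<beta> / (real N)\<^sup>2 * (\<Sum>i\<in>{1..N}. K))"
  proof (rule mult_left_mono)
    have "(\<integral>x. F (empirical N x) \<partial>PiM {1..N} \<pi>) - F \<nu>
        \<le> 2 * \<beta> / (real N)\<^sup>2 * (\<Sum>i\<in>{1..N}. total_variance (\<pi> i))"
      using expected_energy_le unfolding \<nu>_def by linarith
    also have "\<dots> \<le> 2 * \<beta> / (real N)\<^sup>2 * (\<Sum>i\<in>{1..N}. K)"
      using \<beta>_nonneg by (intro mult_left_mono sum_mono var) auto
    finally show "((\<integral>x. F (empirical N x) \<partial>PiM {1..N} \<pi>) - F \<nu>)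
        - ((\<integral>x. (\<Sum>i\<in>{1..N}. g (x i)) / N \<partial>PiM {1..N} \<pi>) - a)
        \<le> 2 * \<beta> / (real N)\<^sup>2 * (\<Sum>i\<in>{1..N}. K)"
      unfolding g_avg by simp
  qed (simp add: k_def)
  \<comment> \<open>N cancels in (2N/\<sigma>^2) (2\<beta>/N^2) (N K).\<close>
  also have "\<dots> = 4 * \<beta> / \<sigma>\<^sup>2 * K"
    using N0 by (simp add: k_def power2_eq_square)
  finally have EG: "(\<integral>x. G x \<partial>PiM {1..N} \<pi>) \<le> 4 * \<beta> / \<sigma>\<^sup>2 * K" .

  define e where "e i x = exp (- V i x - 2 / \<sigma>\<^sup>2 * g x)" for i x
  define Z where "Z i = (\<integral>x. e i x \<partial>lborel)" for i
  have Z: "Z i > 0" for i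
    using \<pi>_density[of i] unfolding density_proportional_def Z_def e_def g_def \<nu>_def by blast
  have [measurable]: "e i \<in> borel_measurable borel" for i unfolding e_def by measurable
  have \<pi>_eq: "\<pi> i = density lborel (\<lambda>x. ennreal (e i x / Z i))" for i
    using \<pi>_density[of i] unfolding density_proportional_def Z_def e_def g_def \<nu>_def by blast
  define p where "p x = (\<Prod>i\<in>{1..N}. e i (x i) / Z i)" for x
  have e_nonneg: "e i x / Z i \<ge> 0" for i x using Z[of i] by (simp add: e_def)
  have p_nonneg: "p x \<ge> 0" for x unfolding p_def by (intro prod_nonneg) (simp add: e_nonneg)
  have p_meas: "p \<in> borel_measurable (PiM {1..N} (\<lambda>_. borel))"
    unfolding p_def by measurable
  have "PiM {1..N} \<pi> = PiM {1..N} (\<lambda>i. density lborel (\<lambda>x. ennreal (e i x / Z i)))"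
    by (rule PiM_cong) (auto simp: \<pi>_eq[symmetric])
  also have "\<dots> = density ?M (\<lambda>x. \<Prod>i\<in>{1..N}. ennreal (e i (x i) / Z i))"
    by (rule PiM_density)
       (auto simp: \<pi>_eq[symmetric] intro: prob_space_imp_sigma_finite prob_\<pi> lborel.sigma_finite_measure_axioms)
  also have "\<dots> = density ?M (\<lambda>x. ennreal (p x))"
    unfolding p_def using e_nonneg by (simp add: prod_ennreal)
  finally have Pi_eq: "PiM {1..N} \<pi> = density ?M (\<lambda>x. ennreal (p x))" .

  define q where "q x = exp (- (\<Sum>i\<in>{1..N}. V i (x i)) - k * F (empirical N x))" for x
  define Z\<^sub>0 where "Z\<^sub>0 = (\<integral>x. q x \<partial>?M)"
  have Z\<^sub>0: "Z\<^sub>0 > 0" and \<mu>_eq: "\<mu> = density ?M (\<lambda>x. ennreal (q x / Z\<^sub>0))"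
    using \<mu> unfolding density_proportional_def Z\<^sub>0_def q_def k_def by blast+
  define z where "z = (\<Prod>i\<in>{1..N}. Z i)"
  \<comment> \<open>Collects what does not depend on x: the normalising constants, and a factor
    compensating the constant part of G.\<close>
  define c where "c = z / Z\<^sub>0 * exp (- k * (F \<nu> - a))"
  have z: "z > 0" unfolding z_def using Z by (intro prod_pos) auto
  have c: "c > 0" using z Z\<^sub>0 by (simp add: c_def)
  have "q x / Z\<^sub>0 = p x * (c * exp (- G x))" for x
  proof -
    have "p x = exp (- (\<Sum>i\<in>{1..N}. V i (x i)) - 2 / \<sigma>\<^sup>2 * (\<Sum>i\<in>{1..N}. g (x i))) / z"
      unfolding p_def e_def prod_dividef z_def
      by (simp add: exp_sum[symmetric] sum_subtractf sum_negf sum_distrib_left)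
    then have "p x * (c * exp (- G x)) = exp (- (\<Sum>i\<in>{1..N}. V i (x i)) - 2 / \<sigma>\<^sup>2 * (\<Sum>i\<in>{1..N}. g (x i)))
        * exp (- k * (F \<nu> - a)) * exp (- G x) / Z\<^sub>0"
      using z by (simp add: c_def)
    also have "\<dots> = exp (- (\<Sum>i\<in>{1..N}. V i (x i)) - 2 / \<sigma>\<^sup>2 * (\<Sum>i\<in>{1..N}. g (x i)) - k * (F \<nu> - a) - G x) / Z\<^sub>0"
      by (simp flip: exp_add)
    also have "- (\<Sum>i\<in>{1..N}. V i (x i)) - 2 / \<sigma>\<^sup>2 * (\<Sum>i\<in>{1..N}. g (x i)) - k * (F \<nu> - a) - G x
        = - (\<Sum>i\<in>{1..N}. V i (x i)) - k * F (empirical N x)"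
    proof -
      have "k * ((\<Sum>i\<in>{1..N}. g (x i)) / N) = 2 / \<sigma>\<^sup>2 * (\<Sum>i\<in>{1..N}. g (x i))"
        using N0 by (simp add: k_def)
      then show ?thesis unfolding G_def right_diff_distrib by linarith
    qed
    finally show ?thesis by (simp add: q_def)
  qed
  then have "\<mu> = density ?M (\<lambda>x. ennreal (p x) * ennreal (c * exp (- G x)))"
    unfolding \<mu>_eq using c p_nonneg by (simp add: ennreal_mult)
  also have "\<dots> = density (density ?M (\<lambda>x. ennreal (p x))) (\<lambda>x. ennreal (c * exp (- G x)))"
    using p_meas G_meas by (intro density_density_eq[symmetric]) (simp_all cong: measurable_cong_sets add: sets_M)
  also have "\<dots> = density (PiM {1..N} \<pi>) (\<lambda>x. ennreal (c * exp (- G x)))"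
    unfolding Pi_eq ..
  finally have gibbs: "\<mu> = density (PiM {1..N} \<pi>) (\<lambda>x. ennreal (c * exp (- G x)))" .
  have "prob_space \<mu>" using \<mu> by (rule prob_space_density_proportional) simp
  from P.KL_gibbs_le[OF G_int G_nonneg c gibbs this] EG show ?thesis by auto
qed

end

theorem theorem7:
  fixes N :: nat
    and \<sigma> \<alpha> \<beta> B C\<^sub>P\<^sub>I :: real
    and V :: "nat \<Rightarrow> real ^ 'd \<Rightarrow> real"
    and F\<^sub>0 :: "(real ^ 'd) measure \<Rightarrow> real"
    and \<delta>F\<^sub>0 :: "(real ^ 'd) measure \<Rightarrow> real ^ 'd \<Rightarrow> real"
    and \<delta>2F\<^sub>0 :: "(real ^ 'd) measure \<Rightarrow> real ^ 'd \<Rightarrow> real ^ 'd \<Rightarrow> real"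
    and \<mu> :: "(nat \<Rightarrow> real ^ 'd) measure"
    and \<pi> :: "nat \<Rightarrow> (real ^ 'd) measure"
  assumes "N \<ge> 1" and "\<sigma> > 0" and "\<alpha> > 0"
    and V: "\<And>i. i \<in> {1..N} \<Longrightarrow> strongly_convex \<alpha> (V i)"
    and first_var: "first_variation F\<^sub>0 \<delta>F\<^sub>0"
    and second_var: "second_variation \<delta>F\<^sub>0 \<delta>2F\<^sub>0"
    and diff1: "\<And>\<nu> x. \<nu> \<in> P2 \<Longrightarrow> \<delta>F\<^sub>0 \<nu> differentiable (at x)"
    and diff2: "\<And>\<nu>. \<nu> \<in> P2 \<Longrightarrow> mixed_differentiable (\<delta>2F\<^sub>0 \<nu>)"
    and A1: "\<And>\<nu>\<^sub>0 \<nu>\<^sub>1 t. \<nu>\<^sub>0 \<in> P2 \<Longrightarrow> \<nu>\<^sub>1 \<in> P2 \<Longrightarrow> t \<in> {0..1} \<Longrightarrow>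
               F\<^sub>0 (lin_interp t \<nu>\<^sub>0 \<nu>\<^sub>1) \<le> (1 - t) * F\<^sub>0 \<nu>\<^sub>0 + t * F\<^sub>0 \<nu>\<^sub>1"
    and A2: "\<And>\<nu> x y. \<nu> \<in> P2 \<Longrightarrow> onorm ((*v) (mixed_derivative (\<delta>2F\<^sub>0 \<nu>) x y)) \<le> \<beta>"
    and A3: "\<And>\<nu> x. \<nu> \<in> P2 \<Longrightarrow> norm (gradient (\<delta>F\<^sub>0 \<nu>) x) \<le> B"
    and \<mu>: "density_proportional \<mu> (PiM {1..N} (\<lambda>_. lborel))
              (\<lambda>x. exp (- (\<Sum>i\<in>{1..N}. V i (x i)) - 2 * real N / \<sigma>\<^sup>2 * F\<^sub>0 (empirical N x)))"
    and \<pi>_P2: "\<And>i. i \<in> {1..N} \<Longrightarrow> \<pi> i \<in> P2"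
    and \<pi>: "\<And>i. i \<in> {1..N} \<Longrightarrow> density_proportional (\<pi> i) lborel
              (\<lambda>x. exp (- V i x - 2 / \<sigma>\<^sup>2 * \<delta>F\<^sub>0 (avg_measure N \<pi>) x))"
    and PI: "\<And>i. i \<in> {1..N} \<Longrightarrow> poincare C\<^sub>P\<^sub>I (\<pi> i)"
  shows "absolutely_continuous (PiM {1..N} \<pi>) \<mu> \<and>
         integrable \<mu> (entropy_density (exp 1) (PiM {1..N} \<pi>) \<mu>) \<and>
         KL_divergence (exp 1) (PiM {1..N} \<pi>) \<mu>
           \<le> 4 * \<beta> / \<sigma>\<^sup>2 *
             min (C\<^sub>P\<^sub>I * real CARD('d)) (2 * real CARD('d) / \<alpha> + 4 * B\<^sup>2 / (\<alpha>\<^sup>2 * \<sigma> ^ 4))"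
proof -
  let ?d = "real CARD('d)"
  \<comment> \<open>The hypotheses on \<open>\<pi>\<close> and \<open>V\<close> concern {1..N} only,
    while the locale speaks of all indices; both families are padded with their member at index
    1.\<close>
  define \<pi>' where "\<pi>' i = \<pi> (if i \<in> {1..N} then i else 1)" for i
  define V' where "V' i = V (if i \<in> {1..N} then i else 1)" for i
  have \<pi>'[simp]: "i \<in> {1..N} \<Longrightarrow> \<pi>' i = \<pi> i" for i by (simp add: \<pi>'_def)
  have V'[simp]: "i \<in> {1..N} \<Longrightarrow> V' i = V i" for i by (simp add: V'_def)
  have idx: "(if i \<in> {1..N} then i else 1) \<in> {1..N}" for i using \<open>N \<ge> 1\<close> by simp
  note \<pi>_density = \<pi>
  interpret mean_field_product F\<^sub>0 \<delta>F\<^sub>0 \<delta>2F\<^sub>0 \<beta> B N \<pi>'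
  proof unfold_locales
    show "\<pi>' i \<in> P2" for i unfolding \<pi>'_def by (rule \<pi>_P2[OF idx])
  qed (fact first_var second_var diff1 diff2 A1 A2 A3 \<open>N \<ge> 1\<close>)+
  have avg: "avg_measure N \<pi>' = avg_measure N \<pi>" by (rule avg_measure_cong) (rule \<pi>')
  have avg_P2: "avg_measure N \<pi> \<in> P2" by (rule avg_measure_in_P2[OF \<open>N \<ge> 1\<close> \<pi>_P2])
  have Pi: "PiM {1..N} \<pi>' = PiM {1..N} \<pi>" by (rule PiM_cong[OF refl \<pi>'])
  have V'_sum: "(\<Sum>i\<in>{1..N}. V' i (x i)) = (\<Sum>i\<in>{1..N}. V i (x i))" for x
    by (rule sum.cong[OF refl]) (simp only: V')
  have V'_meas: "V' i \<in> borel_measurable borel" for i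
    unfolding V'_def
    by (rule borel_measurable_continuous_onI[OF strongly_convex_continuous[OF V[OF idx] \<open>\<alpha> > 0\<close>]])
  have \<pi>'_density: "density_proportional (\<pi>' i) lborel
      (\<lambda>x. exp (- V' i x - 2 / \<sigma>\<^sup>2 * \<delta>F\<^sub>0 (avg_measure N \<pi>') x))" for i
    unfolding avg \<pi>'_def V'_def by (rule \<pi>_density[OF idx])
  have var: "total_variance (\<pi>' i) \<le> min (C\<^sub>P\<^sub>I * ?d) (2 * ?d / \<alpha> + 4 * B\<^sup>2 / (\<alpha>\<^sup>2 * \<sigma> ^ 4))"
    if i: "i \<in> {1..N}" for i
  proof -
    have "\<bar>2 / \<sigma>\<^sup>2 * \<delta>F\<^sub>0 (avg_measure N \<pi>) x - 2 / \<sigma>\<^sup>2 * \<delta>F\<^sub>0 (avg_measure N \<pi>) y\<bar>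
        \<le> 2 / \<sigma>\<^sup>2 * B * norm (x - y)" for x y
      using mult_left_mono[OF dF_lipschitz[OF avg_P2, of x y], of "2 / \<sigma>\<^sup>2"]
      unfolding right_diff_distrib[symmetric] abs_mult by (simp add: mult.assoc)
    from log_concave_perturbation_variance[OF V[OF i] \<open>\<alpha> > 0\<close> this \<pi>_density[OF i] \<pi>_P2[OF i]]
    have "total_variance (\<pi> i) \<le> 2 * ?d / \<alpha> + (2 / \<sigma>\<^sup>2 * B)\<^sup>2 / \<alpha>\<^sup>2" by simp
    also have "(2 / \<sigma>\<^sup>2 * B)\<^sup>2 / \<alpha>\<^sup>2 = 4 * B\<^sup>2 / (\<alpha>\<^sup>2 * \<sigma> ^ 4)"
      by (simp add: power_mult_distrib power_divide mult.commute flip: power_mult)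
    finally show ?thesis
      using poincare_total_variance[OF PI[OF i] \<pi>_P2[OF i]] \<pi>'[OF i] by simp
  qed
  show ?thesis
    using KL_product_le[OF \<open>\<sigma> > 0\<close> V'_meas _ \<pi>'_density var] \<mu> unfolding V'_sum Pi by blast
qed

end
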